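(* Let $d,\ell\ge1$ be integers and let $F:\mathbb{R}^d\rightrightarrows\mathbb{R}^\ell$ be a set-valued map with nonempty convex compact values which is locally isotropically Lipschitz and such that for every $x\in\mathbb{R}^d$ the set $F(x)$ is strictly convex and has nonempty interior. Then for almost every $\bar x\in\mathbb{R}^d$ (with respect to the Lebesgue measure of $\mathbb{R}^d$) and for almost every $\bar y\in\partial F(\bar x)$ (with respect to the $(\ell-1)$-dimensional measure of $\partial F(\bar x)$), $F$ is differentiable at $(\bar x,\bar y)$ and, moreover, $\mathrm{gph}(DF(\bar x,\bar y))$ is a half-space of $\mathbb{R}^d\times\mathbb{R}^\ell$.
   Context: $|\cdot|$ is the Euclidean norm, $\mathrm{B}$ the closed unit ball of $\mathbb{R}^\ell$, and $\partial$ denotes topological boundary. A compact convex set is strictly convex if its boundary contains no nondegenerate segment. The $(\ell-1)$-dimensional measure on the boundary of a compact convex set with nonempty interior is the usual surface (i.e. $(\ell-1)$-dimensional Hausdorff) measure; the boundary is locally the graph of a Lipschitz function of $\ell-1$ variables, and null sets correspond to Lebesgue-null sets in $\mathbb{R}^{\ell-1}$ in these charts. For a set-valued map $F:\mathbb{R}^d\rightrightarrows\mathbb{R}^\ell$ with nonempty convex compact values and $p\in\mathbb{R}^\ell$, set $$\sigma_{F(x)}(p)=\max_{y\in F(x)}\langle p,y\rangle,\qquad Y(x,p)=\{y\in F(x):\ \langle p,y\rangle=\sigma_{F(x)}(p)\}.$$ $F$ is locally isotropically Lipschitz if for every $\bar x\in\mathbb{R}^d$ there exist $k>0$ and a neighborhood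 $U$ of $\bar x$ such that for all $p\in\mathbb{R}^\ell$ and all $x,x'\in U$, $$Y(x,p)\subset Y(x',p)+k\,|x-x'|\,\mathrm{B}.$$ For a closed set $K\subset\mathbb{R}^m$ and $\bar z\in K$, the tangent (contingent) cone is $$T_K(\bar z)=\{u\in\mathbb{R}^m:\ \exists\, h_n>0,\ h_n\to 0,\ \exists\, u_n\to u \text{ such that } \bar z+h_nu_n\in K\ \forall n\}.$$ The graph of $F$ is $\mathrm{gph}(F)=\{(x,y):\ y\in F(x)\}$. If $F$ has closed graph, its graphical derivative at $(\bar x,\bar y)\in\mathrm{gph}(F)$ is the set-valued map $DF(\bar x,\bar y):\mathbb{R}^d\rightrightarrows\mathbb{R}^\ell$ defined by $\mathrm{gph}(DF(\bar x,\bar y))=T_{\mathrm{gph}(F)}(\bar x,\bar y)$. A convex process is a set-valued map $\mathbb{R}^d\rightrightarrows\mathbb{R}^\ell$ whose graph is a closed convex cone in $\mathbb{R}^d\times\mathbb{R}^\ell$. $F$ (with closed graph) is said to be differentiable at $(\bar x,\bar y)\in\mathrm{gph}(F)$ if $DF(\bar x,\bar y)$ is a convex process, i.e. if the closed cone $T_{\mathrm{gph}(F)}(\bar x,\bar y)$ is convex. *)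

theory Defs
  imports "HOL-Analysis.Analysis"
begin

text \<open>The pieces of a cover are required to be bounded because \<^term>\<open>diameter\<close> is
  unspecified on unbounded sets. The empty set contributes 0 also for \<open>m = 0\<close>, while a
  singleton then contributes \<open>0 ^ 0 = 1\<close>, so that the case \<open>m = 0\<close> is the counting measure.
  The constant normalises the measure to agree with Lebesgue measure on \<open>\<real>\<^sup>m\<close>.\<close>

definition hausdorff_pre :: "nat \<Rightarrow> real \<Rightarrow> 'a::metric_space set \<Rightarrow> ennreal" where
  "hausdorff_pre m \<delta> A =
     (INF E \<in> {E :: nat \<Rightarrow> 'a set. A \<subseteq> (\<Union>n. E n) \<and> (\<forall>n. bounded (E n) \<and> diameter (E n) \<le> \<delta>)}.
        \<Sum>n. if E n = {} then 0 else ennreal (unit_ball_vol (real m) * (diameter (E n) / 2) ^ m))"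

text \<open>This is the outer measure, defined on all sets; a set is null for the \<open>m\<close>-dimensional
  Hausdorff measure iff its outer measure vanishes.\<close>

definition hausdorff_measure :: "nat \<Rightarrow> 'a::metric_space set \<Rightarrow> ennreal" where
  "hausdorff_measure m A = (SUP \<delta> \<in> {0<..}. hausdorff_pre m \<delta> A)"

definition strictly_convex :: "'a::euclidean_space set \<Rightarrow> bool" where
  "strictly_convex K \<longleftrightarrow> compact K \<and> convex K \<and>
     (\<forall>a b. closed_segment a b \<subseteq> frontier K \<longrightarrow> a = b)"

text \<open>For nonempty compact \<open>K\<close> the supremum is attained, i.e. it is the maximum.\<close>

definition support_fun :: "'a::euclidean_space set \<Rightarrow> 'a \<Rightarrow> real" where
  "support_fun K p = (SUP y\<in>K. p \<bullet> y)"

definition support_set :: "('a \<Rightarrow> 'b::euclidean_space set) \<Rightarrow> 'a \<Rightarrow> 'b \<Rightarrow> 'b set" where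
  "support_set F x p = {y \<in> F x. p \<bullet> y = support_fun (F x) p}"

definition locally_isotropically_Lipschitz ::
    "('a::euclidean_space \<Rightarrow> 'b::euclidean_space set) \<Rightarrow> bool" where
  "locally_isotropically_Lipschitz F \<longleftrightarrow>
     (\<forall>x0. \<exists>k>0. \<exists>U. open U \<and> x0 \<in> U \<and>
        (\<forall>p. \<forall>x\<in>U. \<forall>x'\<in>U.
           support_set F x p \<subseteq>
             {y + (k * norm (x - x')) *\<^sub>R b | y b. y \<in> support_set F x' p \<and> b \<in> cball 0 1}))"

definition tangent_cone :: "'a::real_normed_vector set \<Rightarrow> 'a \<Rightarrow> 'a set" where
  "tangent_cone K z =
     {u. \<exists>(h :: nat \<Rightarrow> real) (v :: nat \<Rightarrow> 'a).
           (\<forall>n. h n > 0) \<and> h \<longlonglongrightarrow> 0 \<and> v \<longlonglongrightarrow> u \<and> (\<forall>n. z + h n *\<^sub>R v n \<in> K)}"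

definition gph :: "('a \<Rightarrow> 'b set) \<Rightarrow> ('a \<times> 'b) set" where
  "gph F = {(x, y). y \<in> F x}"

definition graphical_derivative ::
    "('a::real_normed_vector \<Rightarrow> 'b::real_normed_vector set) \<Rightarrow> 'a \<Rightarrow> 'b \<Rightarrow> 'a \<Rightarrow> 'b set" where
  "graphical_derivative F x y = (\<lambda>u. {v. (u, v) \<in> tangent_cone (gph F) (x, y)})"

definition convex_process ::
    "('a::real_normed_vector \<Rightarrow> 'b::real_normed_vector set) \<Rightarrow> bool" where
  "convex_process G \<longleftrightarrow> closed (gph G) \<and> convex_cone (gph G)"

definition sv_differentiable ::
    "('a::real_normed_vector \<Rightarrow> 'b::real_normed_vector set) \<Rightarrow> 'a \<Rightarrow> 'b \<Rightarrow> bool" where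
  "sv_differentiable F x y \<longleftrightarrow>
     closed (gph F) \<and> (x, y) \<in> gph F \<and> convex_process (graphical_derivative F x y)"

definition half_space :: "'a::real_inner set \<Rightarrow> bool" where
  "half_space H \<longleftrightarrow> (\<exists>a c. a \<noteq> 0 \<and> H = {z. a \<bullet> z \<le> c})"

end

theory Submission
  imports Defs
begin

text \<open>Locally in \<open>x\<close>, a fixed ball around some \<open>c\<close> is contained in all \<open>F x\<close>, and the Minkowski functional
  \<open>G (x, w)\<close> of \<open>F x - c\<close> at \<open>w\<close> is locally Lipschitz in both variables jointly. The graph of \<open>F\<close> is the
  sublevel set \<open>G (x, y - c) \<le> 1\<close> and the boundaries \<open>frontier (F x)\<close> are given by \<open>G (x, y - c) = 1\<close>. At a
  boundary point where \<open>G\<close> is differentiable, the derivative does not vanish, since \<open>G\<close> is positively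
  homogeneous in \<open>w\<close>, and so the tangent cone of the graph is a half-space. By Rademacher's theorem and
  Fubini's theorem, for almost every \<open>x\<close> the function \<open>G\<close> is differentiable at \<open>(x, w)\<close> for almost every
  \<open>w\<close>. By homogeneity the exceptional \<open>w\<close> form a cone, and a Lebesgue null cone meets the boundary in a
  set of vanishing \<open>(l - 1)\<close>-dimensional measure by Eilenberg's inequality.

  Rademacher's theorem is proved without integration by parts: in one variable, a Lipschitz function is,
  up to a linear term, the indefinite integral of a density, and at density points of the set where that
  density lies in a short interval, the function is almost linear. The set of points at which a function of
  several variables is almost linear with given slope and given radius in every coordinate direction is
  closed, and at its points of non-porosity the function is almost linear in all directions.\<close>


section \<open>Lebesgue density and porosity\<close>

text \<open>Countable additivity over the disjoint balls adds up the local density bounds. The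
  family will be one supplied by Vitali's theorem inside an open set \<open>T\<close>.\<close>

lemma emeasure_UN_balls_le:
  fixes S :: "'a::euclidean_space set"
  assumes S: "S \<in> sets lebesgue" and C: "countable C" and T: "T \<in> lmeasurable" and c: "0 \<le> c"
    and pw: "pairwise (\<lambda>i j. disjnt (ball (a i) (r i)) (ball (a j) (r j))) C"
    and sub: "\<And>i. i \<in> C \<Longrightarrow> ball (a i) (r i) \<subseteq> T"
    and le: "\<And>i. i \<in> C \<Longrightarrow> measure lebesgue (S \<inter> ball (a i) (r i)) \<le> c * measure lebesgue (ball (a i) (r i))"
  shows "emeasure lebesgue (\<Union>i\<in>C. S \<inter> ball (a i) (r i)) \<le> ennreal (c * measure lebesgue T)"
proof -
  have dis: "disjoint_family_on (\<lambda>i. ball (a i) (r i)) C"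
    using pw by (auto simp: disjoint_family_on_def pairwise_def disjnt_def)
  then have dis': "disjoint_family_on (\<lambda>i. S \<inter> ball (a i) (r i)) C"
    by (fastforce simp: disjoint_family_on_def)
  have "emeasure lebesgue (\<Union>i\<in>C. S \<inter> ball (a i) (r i))
        = (\<integral>\<^sup>+i. emeasure lebesgue (S \<inter> ball (a i) (r i)) \<partial>count_space C)"
    using S C dis' by (intro emeasure_UN_countable) auto
  also have "\<dots> \<le> (\<integral>\<^sup>+i. ennreal c * emeasure lebesgue (ball (a i) (r i)) \<partial>count_space C)"
  proof (intro nn_integral_mono)
    fix i assume "i \<in> space (count_space C)"
    then have i: "i \<in> C" by simp
    have "S \<inter> ball (a i) (r i) \<in> lmeasurable" "ball (a i) (r i) \<in> lmeasurable"
      using S by (auto simp: fmeasurable_Int_fmeasurable Int_commute[of S])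
    then show "emeasure lebesgue (S \<inter> ball (a i) (r i)) \<le> ennreal c * emeasure lebesgue (ball (a i) (r i))"
      using le[OF i] c by (simp add: emeasure_eq_measure2 ennreal_mult'[symmetric] ennreal_leI)
  qed
  also have "\<dots> = ennreal c * (\<integral>\<^sup>+i. emeasure lebesgue (ball (a i) (r i)) \<partial>count_space C)"
    by (simp add: nn_integral_cmult)
  also have "(\<integral>\<^sup>+i. emeasure lebesgue (ball (a i) (r i)) \<partial>count_space C) = emeasure lebesgue (\<Union>i\<in>C. ball (a i) (r i))"
    using C dis by (intro emeasure_UN_countable[symmetric]) auto
  also have "\<dots> \<le> emeasure lebesgue T"
    using sub T by (intro emeasure_mono) auto
  finally show ?thesis
    using T c by (simp add: emeasure_eq_measure2 ennreal_mult' mult_left_mono)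
qed

lemma outer_open_lmeasurable:
  fixes S :: "'a::euclidean_space set"
  assumes "S \<in> lmeasurable" "e > 0"
  obtains T where "open T" "S \<subseteq> T" "T \<in> lmeasurable" "measure lebesgue T \<le> measure lebesgue S + e"
proof -
  obtain T where T: "open T" "S \<subseteq> T" "T - S \<in> lmeasurable" "emeasure lebesgue (T - S) < ennreal e"
    using sets_lebesgue_outer_open[of S e] assms by auto
  have eq: "T = S \<union> (T - S)" using T by auto
  have "T \<in> lmeasurable" using assms T by (subst eq) (intro fmeasurable.Un)
  moreover have "measure lebesgue (T - S) < e"
    using T assms by (simp add: emeasure_eq_measure2 ennreal_less_iff)
  moreover have "measure lebesgue T \<le> measure lebesgue S + measure lebesgue (T - S)"
    using assms T by (subst eq) (rule measure_Un_le, auto)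
  ultimately show ?thesis using T that by force
qed

text \<open>Disjoint small balls of low density inside a nearly optimal open cover of
  \<open>P\<close> yield an open cover smaller by a factor below 1, up to an arbitrarily small
  error. Hence the infimum of the measures of such covers is 0.\<close>

lemma negligible_low_density_bounded:
  fixes P :: "'a::euclidean_space set"
  assumes S: "S \<in> sets lebesgue" and PS: "P \<subseteq> S" and c: "c < 1" and bdd: "bounded P"
    and dens: "\<And>x e. x \<in> P \<Longrightarrow> e > 0 \<Longrightarrow>
       \<exists>r>0. r < e \<and> measure lebesgue (S \<inter> ball x r) \<le> c * measure lebesgue (ball x r)"
  shows "negligible P"
proof -
  \<comment> \<open>\<open>c\<close> may be negative; \<open>c'\<close> is a nonnegative bound that
    is still below 1.\<close>
  define c' where "c' = max c 0"
  have c': "0 \<le> c'" "c' < 1" "c \<le> c'" using c by (auto simp: c'_def)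
  \<comment> \<open>\<open>P\<close> is not assumed measurable, so its size is taken as the infimum
    \<open>m\<close> over open sets of finite measure that contain it.\<close>
  define A where "A = {measure lebesgue T | T. open T \<and> P \<subseteq> T \<and> T \<in> lmeasurable}"
  define m where "m = Inf A"
  obtain R where R: "P \<subseteq> ball 0 R"
    using bdd bounded_subset_ballD by blast
  have A0: "A \<noteq> {}" unfolding A_def using R by (auto intro!: exI[of _ "ball 0 R"])
  have Abdd: "bdd_below A" unfolding A_def by (rule bdd_belowI[of _ 0]) auto
  have m0: "m \<ge> 0" unfolding m_def using A0 by (intro cInf_greatest) (auto simp: A_def)
  have step: "m \<le> c' * measure lebesgue T + e"
    if T: "open T" "P \<subseteq> T" "T \<in> lmeasurable" and e: "e > 0" for T e
  proof -
    define K where "K = {(x, r). x \<in> P \<and> 0 < r \<and> ball x r \<subseteq> T \<and>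
        measure lebesgue (S \<inter> ball x r) \<le> c * measure lebesgue (ball x r)}"
    have "\<exists>i. i \<in> K \<and> x \<in> ball (fst i) (snd i) \<and> snd i < d"
      if x: "x \<in> P" and d: "0 < d" for x d
    proof -
      obtain \<delta> where \<delta>: "\<delta> > 0" "ball x \<delta> \<subseteq> T"
        using T x by (meson open_contains_ball subsetD)
      obtain r where r: "r > 0" "r < min d \<delta>" "measure lebesgue (S \<inter> ball x r) \<le> c * measure lebesgue (ball x r)"
        using dens[OF x, of "min d \<delta>"] \<delta> d by auto
      have "ball x r \<subseteq> T" using \<delta> r by (auto simp: subset_iff)
      then show ?thesis using r x by (intro exI[of _ "(x, r)"]) (auto simp: K_def)
    qed
    then obtain C where C: "countable C" "C \<subseteq> K"
      "pairwise (\<lambda>i j. disjnt (ball (fst i) (snd i)) (ball (fst j) (snd j))) C"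
      "negligible (P - (\<Union>i\<in>C. ball (fst i) (snd i)))"
      by (rule Vitali_covering_theorem_balls[of P K fst snd])
    have meas: "(\<Union>i\<in>C. S \<inter> ball (fst i) (snd i)) \<in> sets lebesgue"
      by (rule sets.countable_UN'[OF C(1)]) (use S in auto)
    \<comment> \<open>Only the parts of the balls inside \<open>S\<close> are counted; since
      \<open>P\<close> lies in \<open>S\<close>, they still cover \<open>P\<close> together with the
      null set \<open>N\<close>.\<close>
    define N where "N = P - (\<Union>i\<in>C. ball (fst i) (snd i))"
    define U where "U = (\<Union>i\<in>C. S \<inter> ball (fst i) (snd i)) \<union> N"
    have N: "N \<in> null_sets lebesgue" using C(4) by (simp add: N_def negligible_iff_null_sets)
    have "emeasure lebesgue (\<Union>i\<in>C. S \<inter> ball (fst i) (snd i)) \<le> ennreal (c' * measure lebesgue T)"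
    proof (rule emeasure_UN_balls_le[OF S C(1) T(3) c'(1) C(3)])
      fix i assume "i \<in> C"
      then have i: "i \<in> K" using C by auto
      then show "ball (fst i) (snd i) \<subseteq> T" by (auto simp: K_def)
      have "c * measure lebesgue (ball (fst i) (snd i)) \<le> c' * measure lebesgue (ball (fst i) (snd i))"
        using c' by (intro mult_right_mono) auto
      then show "measure lebesgue (S \<inter> ball (fst i) (snd i)) \<le> c' * measure lebesgue (ball (fst i) (snd i))"
        using i by (auto simp: K_def intro: order_trans[OF _ mult_right_mono])
    qed
    moreover have "emeasure lebesgue U = emeasure lebesgue (\<Union>i\<in>C. S \<inter> ball (fst i) (snd i))"
      unfolding U_def by (rule emeasure_Un_null_set[OF meas N])
    ultimately have eU: "emeasure lebesgue U \<le> ennreal (c' * measure lebesgue T)" by simp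
    have "U \<in> sets lebesgue" unfolding U_def
      using meas N by (intro sets.Un) auto
    then have Um: "U \<in> lmeasurable" using eU by (intro fmeasurableI) (auto simp: order_le_less_trans)
    have mU: "measure lebesgue U \<le> c' * measure lebesgue T"
      using eU Um c' by (simp add: emeasure_eq_measure2)
    have PU: "P \<subseteq> U" using PS by (auto simp: U_def N_def)
    obtain T' where T': "open T'" "U \<subseteq> T'" "T' \<in> lmeasurable" "measure lebesgue T' \<le> measure lebesgue U + e"
      using outer_open_lmeasurable[OF Um e] by blast
    then have "measure lebesgue T' \<in> A"
      unfolding A_def using PU by (intro CollectI exI[of _ T'] conjI refl) auto
    then have "m \<le> measure lebesgue T'" unfolding m_def using Abdd by (rule cInf_lower)
    then show ?thesis using T' mU by linarith
  qed
  have "m \<le> c' * m"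
  proof (rule field_le_epsilon)
    fix e :: real assume e: "e > 0"
    obtain z where z: "z \<in> A" "z < m + e/2"
      using cInf_lessD[OF A0, of "m + e/2"] e by (auto simp: m_def)
    then obtain T where T: "open T" "P \<subseteq> T" "T \<in> lmeasurable" "z = measure lebesgue T"
      by (auto simp: A_def)
    have "c' * (z - m) \<le> 1 * (e/2)"
      using c' z(2) e by (intro mult_mono') (use m_def cInf_lower[OF z(1) Abdd] in auto)
    then show "m \<le> c' * m + e" using step[OF T(1-3), of "e/2"] T(4) e by (simp add: algebra_simps)
  qed
  then have "m = 0" using c' m0 by (metis mult_le_cancel_right1 mult.commute order.antisym not_le)
  show ?thesis unfolding negligible_outer_le
  proof (intro allI impI)
    fix e :: real assume "e > 0"
    then obtain z where z: "z \<in> A" "z < e"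
      using cInf_lessD[OF A0, of "e"] \<open>m = 0\<close> by (auto simp: m_def)
    then show "\<exists>T. P \<subseteq> T \<and> T \<in> lmeasurable \<and> measure lebesgue T \<le> e" by (auto simp: A_def)
  qed
qed

lemma negligible_if_bounded_parts:
  fixes P :: "'a::euclidean_space set"
  assumes "\<And>n::nat. negligible (P \<inter> ball 0 n)"
  shows "negligible P"
proof -
  have "P = (\<Union>n::nat. P \<inter> ball 0 n)"
    using reals_Archimedean2 by (auto simp: dist_norm)
  then show ?thesis using assms negligible_countable_Union[of "range (\<lambda>n::nat. P \<inter> ball 0 n)"] by auto
qed

lemma negligible_low_density:
  fixes P :: "'a::euclidean_space set"
  assumes S: "S \<in> sets lebesgue" and PS: "P \<subseteq> S" and c: "c < 1" 
    and dens: "\<And>x e. x \<in> P \<Longrightarrow> e > 0 \<Longrightarrow>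
       \<exists>r>0. r < e \<and> measure lebesgue (S \<inter> ball x r) \<le> c * measure lebesgue (ball x r)"
  shows "negligible P"
proof (rule negligible_if_bounded_parts)
  show "negligible (P \<inter> ball 0 n)" for n :: nat
    using PS dens by (intro negligible_low_density_bounded[OF S _ c]) auto
qed

text \<open>Lower porosity of \<open>S\<close> at \<open>x\<close> costs a fixed fraction of the ball.\<close>

lemma negligible_porous:
  fixes S :: "'a::euclidean_space set"
  assumes S: "S \<in> sets lebesgue" and \<eta>: "\<eta> > 0"
  shows "negligible {x \<in> S. \<forall>e>0. \<exists>z. z \<noteq> x \<and> dist x z < e \<and> S \<inter> ball z (\<eta> * dist x z) = {}}"
proof (rule negligible_low_density[OF S])
  \<comment> \<open>Capping at 1 keeps the hole \<open>ball z (\<theta> * d)\<close> inside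
    \<open>ball x (2 * d)\<close>, of which it fills the fraction
    \<open>(\<theta>/2) ^ ?n\<close>.\<close>
  define \<theta> where "\<theta> = min \<eta> 1"
  have \<theta>: "0 < \<theta>" "\<theta> \<le> \<eta>" "\<theta> \<le> 1" using \<eta> by (auto simp: \<theta>_def)
  let ?n = "DIM('a)"
  show "1 - (\<theta>/2) ^ ?n < 1" using \<theta> by simp
  fix x and e :: real
  assume x: "x \<in> {x \<in> S. \<forall>e>0. \<exists>z. z \<noteq> x \<and> dist x z < e \<and> S \<inter> ball z (\<eta> * dist x z) = {}}" and e: "e > 0"
  then obtain z where z: "z \<noteq> x" "dist x z < e/2" "S \<inter> ball z (\<eta> * dist x z) = {}"
    by (auto dest!: spec[of _ "e/2"])
  define d where "d = dist x z"
  have d: "d > 0" using z by (simp add: d_def)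
  have "\<theta> * d \<le> \<eta> * d" using \<theta> d by simp
  then have "ball z (\<theta> * d) \<subseteq> ball z (\<eta> * d)" by auto
  then have disj: "S \<inter> ball z (\<theta> * d) = {}" using z unfolding d_def by blast
  have "ball z (\<theta> * d) \<subseteq> ball x (2 * d)"
  proof
    fix w assume "w \<in> ball z (\<theta> * d)"
    then have "dist z w < \<theta> * d" by simp
    moreover have "\<theta> * d \<le> d" using \<theta> d by simp
    ultimately show "w \<in> ball x (2*d)" using dist_triangle[of x w z] by (simp add: d_def)
  qed
  then have "measure lebesgue (S \<inter> ball x (2*d)) \<le> measure lebesgue (ball x (2*d) - ball z (\<theta>*d))"
    using S disj by (intro measure_mono_fmeasurable) auto
  also have "\<dots> = measure lebesgue (ball x (2*d)) - measure lebesgue (ball z (\<theta>*d))"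
    using \<open>ball z (\<theta> * d) \<subseteq> ball x (2 * d)\<close> emeasure_lborel_ball_finite[of x "2*d"]
    by (intro measure_Diff) auto
  also have "measure lebesgue (ball z (\<theta>*d)) = (\<theta>/2)^?n * measure lebesgue (ball x (2*d))"
    using \<theta> d by (simp add: content_ball_conv_unit_ball[of _ z] content_ball_conv_unit_ball[of _ x] power_mult_distrib power_divide)
  finally have "measure lebesgue (S \<inter> ball x (2*d)) \<le> (1 - (\<theta>/2)^?n) * measure lebesgue (ball x (2*d))"
    by (simp add: algebra_simps)
  then show "\<exists>r>0. r < e \<and> measure lebesgue (S \<inter> ball x r) \<le> (1 - (\<theta>/2)^?n) * measure lebesgue (ball x r)"
    using d z by (intro exI[of _ "2*d"]) (auto simp: d_def)
qed auto

section \<open>Lipschitz functions of one variable\<close>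

text \<open>A deficit of \<delta> t on one side of x remains a deficit of \<delta> t in the ball of
  length 2 t, since the other side contributes at most t. This is low density with constant
  \<open>1 - \<delta>/2\<close>.\<close>

lemma negligible_not_one_sided_density:
  fixes S :: "real set"
  assumes S: "S \<in> sets lebesgue" and \<delta>: "\<delta> > 0"
  shows "negligible {x \<in> S. \<not> (\<exists>e>0. \<forall>t. 0 < t \<and> t < e \<longrightarrow>
     (1 - \<delta>) * t \<le> measure lebesgue (S \<inter> {x..x+t}) \<and> (1 - \<delta>) * t \<le> measure lebesgue (S \<inter> {x-t..x}))}"
proof (rule negligible_low_density[OF S])
  show "1 - \<delta>/2 < 1" using \<delta> by simp
  fix x e :: real
  assume x: "x \<in> {x \<in> S. \<not> (\<exists>e>0. \<forall>t. 0 < t \<and> t < e \<longrightarrow>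
     (1 - \<delta>) * t \<le> measure lebesgue (S \<inter> {x..x+t}) \<and> (1 - \<delta>) * t \<le> measure lebesgue (S \<inter> {x-t..x}))}" and e: "e > 0"
  then obtain t where t: "0 < t" "t < e" 
    and lt: "measure lebesgue (S \<inter> {x..x+t}) < (1 - \<delta>) * t \<or> measure lebesgue (S \<inter> {x-t..x}) < (1 - \<delta>) * t"
    by (auto simp: not_le) 
  have fm: "S \<inter> {a..b} \<in> lmeasurable" for a b using S by (simp add: fmeasurable_Int_fmeasurable Int_commute[of S])
  have "measure lebesgue (S \<inter> ball x t) \<le> measure lebesgue ((S \<inter> {x-t..x}) \<union> (S \<inter> {x..x+t}))"
    using S fm by (intro measure_mono_fmeasurable) (auto simp: dist_real_def)
  also have "\<dots> \<le> measure lebesgue (S \<inter> {x-t..x}) + measure lebesgue (S \<inter> {x..x+t})"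
    using fm by (intro measure_Un_le) (auto intro: fmeasurableD)
  finally have 1: "measure lebesgue (S \<inter> ball x t) \<le> measure lebesgue (S \<inter> {x-t..x}) + measure lebesgue (S \<inter> {x..x+t})" .
  have 2: "measure lebesgue (S \<inter> {a..b}) \<le> b - a" if "a \<le> b" for a b
  proof -
    have "measure lebesgue (S \<inter> {a..b}) \<le> measure lebesgue {a..b}"
      using S by (intro measure_mono_fmeasurable) auto
    then show ?thesis using that by simp
  qed
  have "measure lebesgue (ball x t) = 2 * t" using t by (simp add: ball_eq_greaterThanLessThan)
  then have "measure lebesgue (S \<inter> ball x t) \<le> (1 - \<delta>/2) * measure lebesgue (ball x t)"
    using 1 2[of "x-t" x] 2[of x "x+t"] lt t by (auto simp: algebra_simps)
  then show "\<exists>r>0. r < e \<and> measure lebesgue (S \<inter> ball x r) \<le> (1 - \<delta>/2) * measure lebesgue (ball x r)"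
    using t by blast
qed (rule Collect_restrict)

text \<open>The density is that of the image of Lebesgue measure under the inverse of \<open>g\<close>.\<close>

lemma bilipschitz_density:
  fixes g :: "real \<Rightarrow> real"
  assumes g: "\<And>x y. x \<le> y \<Longrightarrow> y - x \<le> g y - g x" "\<And>x y. x \<le> y \<Longrightarrow> g y - g x \<le> M * (y - x)"
  obtains h :: "real \<Rightarrow> ennreal" where "h \<in> borel_measurable borel"
    "\<And>x y. x \<le> y \<Longrightarrow> (\<integral>\<^sup>+u\<in>{x..y}. h u \<partial>lborel) = ennreal (g y - g x)"
proof -
  have mono: "x \<le> y \<longleftrightarrow> g x \<le> g y" for x y
    using g(1)[of x y] g(1)[of y x] by linarith
  have lip: "\<bar>g y - g x\<bar> \<le> M * \<bar>y - x\<bar>" for x y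
    using g[of x y] g[of y x] by (cases "x \<le> y") (auto simp: abs_if)
  have expand: "\<bar>y - x\<bar> \<le> \<bar>g y - g x\<bar>" for x y
    using g(1)[of x y] g(1)[of y x] by linarith
  have M: "M \<ge> 0" using lip[of 1 0] by auto
  have "M-lipschitz_on UNIV g" using lip M by (intro lipschitz_onI) (auto simp: dist_real_def)
  then have contg: "continuous_on A g" for A
    by (meson continuous_on_subset lipschitz_on_continuous_on subset_UNIV)
  have inj: "inj g" using expand by (metis abs_le_zero_iff diff_self eq_iff_diff_eq_0 injI abs_zero)
  have "\<exists>x. g x = y" for y
  proof -
    define u where "u = \<bar>y\<bar> + \<bar>g 0\<bar>"
    have "u \<ge> 0" by (simp add: u_def)
    then have "g (-u) \<le> y" "y \<le> g u" "-u \<le> u"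
      using g(1)[of 0 u] g(1)[of "-u" 0] unfolding u_def by linarith+
    then show ?thesis using IVT'[of g "-u" y u] contg by blast
  qed
  then have surj: "surj g" by (metis surjI)
  define k where "k = inv g"
  have gk [simp]: "g (k y) = y" and kg [simp]: "k (g x) = x" for x y
    using inj surj by (simp_all add: k_def surj_f_inv_f)
  have "1-lipschitz_on UNIV k"
    using expand[of "k _" "k _"] by (intro lipschitz_onI) (auto simp: dist_real_def)
  then have k: "k \<in> borel_measurable borel"
    by (intro borel_measurable_continuous_onI lipschitz_on_continuous_on)
  define \<nu> where "\<nu> = distr lborel borel k"
  have vim: "k -` A = g ` A" for A by (force simp: image_iff)
  \<comment> \<open>A preimage under the inverse \<open>k\<close> is an image under the Lipschitz
    map \<open>g\<close>, which maps null sets to null sets; so Radon-Nikodym applies.\<close>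
  have ac: "absolutely_continuous lborel \<nu>"
    unfolding absolutely_continuous_def
  proof
    fix A assume A: "A \<in> null_sets (lborel :: real measure)"
    then have Ab: "A \<in> sets borel" by auto
    have "negligible A" using A by (simp add: negligible_iff_null_sets null_sets_completionI)
    then have "negligible (g ` A)"
      by (intro negligible_locally_Lipschitz_image[OF _ \<open>negligible A\<close>])
         (auto intro!: exI[of _ UNIV] exI[of _ M] simp: lip)
    then have "k -` A \<in> null_sets lebesgue" by (simp add: vim negligible_iff_null_sets)
    moreover have "k -` A \<in> sets borel" using measurable_sets[OF k Ab] by simp
    ultimately have "k -` A \<in> null_sets lborel" by (simp add: null_sets_completion_iff)
    then show "A \<in> null_sets \<nu>" using Ab k by (auto simp: \<nu>_def null_sets_def emeasure_distr)
  qed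
  obtain h where h: "h \<in> borel_measurable lborel" "density lborel h = \<nu>"
    using sigma_finite_measure.Radon_Nikodym[OF sigma_finite_lborel ac] by (auto simp: \<nu>_def)
  show ?thesis
  proof
    show "h \<in> borel_measurable borel" using h by simp
    fix x y :: real assume "x \<le> y"
    have "k -` {x..y} = {g x..g y}"
      using mono[of x "k _"] mono[of "k _" y] by auto
    then have "emeasure \<nu> {x..y} = ennreal (g y - g x)"
      using \<open>x \<le> y\<close> mono[of x y] k by (simp add: \<nu>_def emeasure_distr)
    then show "(\<integral>\<^sup>+u\<in>{x..y}. h u \<partial>lborel) = ennreal (g y - g x)"
      unfolding h(2)[symmetric] using h(1) by (simp add: emeasure_density)
  qed
qed

text \<open>These bounds nearly determine an increment with density \<open>h\<close> once the points
  where \<open>h\<close> lies in a short interval fill almost all of \<open>I\<close>; the rest of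
  \<open>I\<close> costs at most \<open>M\<close> per unit length.\<close>

lemma
  fixes g :: "real \<Rightarrow> real" and h :: "real \<Rightarrow> ennreal"
  assumes h: "h \<in> borel_measurable borel"
    and int: "(\<integral>\<^sup>+u\<in>I. h u \<partial>lborel) = ennreal G" and I: "I \<in> sets borel" "emeasure lborel I < \<infinity>" and G: "0 \<le> G"
  shows nn_set_integral_lower: "0 \<le> a \<Longrightarrow> a * measure lborel ({x. ennreal a \<le> h x \<and> h x \<le> b} \<inter> I) \<le> G"
    and nn_set_integral_upper: "0 \<le> b' \<Longrightarrow> 0 \<le> M \<Longrightarrow> (AE x in lborel. h x \<le> ennreal M) \<Longrightarrow> 
     G \<le> b' * measure lborel ({x. c \<le> h x \<and> h x \<le> ennreal b'} \<inter> I) +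
         M * (measure lborel I - measure lborel ({x. c \<le> h x \<and> h x \<le> ennreal b'} \<inter> I))"
proof -
  have fin: "emeasure lborel (A \<inter> I) \<noteq> top" for A
    using le_less_trans[OF emeasure_mono[of "A \<inter> I" I lborel] I(2)] I(1) by simp
  {
    assume a: "0 \<le> a"
    let ?S = "{x. ennreal a \<le> h x \<and> h x \<le> b} \<inter> I"
    have S: "?S \<in> sets borel" using h I by measurable
    have "ennreal (a * measure lborel ?S) = ennreal a * emeasure lborel ?S"
      using emeasure_eq_ennreal_measure[OF fin] by (simp only: ennreal_mult'[OF a])
    also have "\<dots> = (\<integral>\<^sup>+u. ennreal a * indicator ?S u \<partial>lborel)"
      by (rule nn_integral_cmult_indicator[symmetric]) (use S in simp)
    also have "\<dots> \<le> (\<integral>\<^sup>+u\<in>I. h u \<partial>lborel)"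
      by (intro nn_integral_mono) (simp add: indicator_def)
    also have "\<dots> = ennreal G" by (rule int)
    finally show "a * measure lborel ?S \<le> G" by (rule ennreal_le_iff[OF G, THEN iffD1])
  }
  {
    assume b: "0 \<le> b'" and M: "0 \<le> M" and ae: "AE x in lborel. h x \<le> ennreal M"
    let ?S = "{x. c \<le> h x \<and> h x \<le> ennreal b'} \<inter> I"
    have S: "?S \<in> sets borel" using h I by measurable
    have d: "emeasure lborel (I - ?S) \<noteq> top" 
      using fin[of "- ?S"] by (simp add: Int_commute Diff_eq)
    have "ennreal G = (\<integral>\<^sup>+u\<in>I. h u \<partial>lborel)" by (rule int[symmetric])
    also have "\<dots> \<le> (\<integral>\<^sup>+u. ennreal b' * indicator ?S u + ennreal M * indicator (I - ?S) u \<partial>lborel)"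
      using ae by (intro nn_integral_mono_AE) (auto simp: indicator_def elim!: eventually_mono)
    also have "\<dots> = ennreal b' * emeasure lborel ?S + ennreal M * emeasure lborel (I - ?S)"
      using S I by (subst nn_integral_add) (auto simp: nn_integral_cmult)
    also have "\<dots> = ennreal (b' * measure lborel ?S + M * measure lborel (I - ?S))"
      using S I fin d b M by (simp add: emeasure_eq_ennreal_measure ennreal_mult')
    finally have "G \<le> b' * measure lborel ?S + M * measure lborel (I - ?S)"
      using b M by (subst (asm) ennreal_le_iff) auto
    moreover have "measure lborel (I - ?S) = measure lborel I - measure lborel ?S"
      using I S fin[of UNIV] by (intro measure_Diff) auto
    ultimately show "G \<le> b' * measure lborel ?S + M * (measure lborel I - measure lborel ?S)" by simp
  }
qed


text \<open>Points are sorted by the density of a tilted copy \<open>g\<close> of \<open>f\<close>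
  into slices of width \<open>\<epsilon> / 2\<close>. Almost every point is a density point of its
  slice, and there the increments of \<open>g\<close> are almost the slice value times the
  length.\<close>

lemma lipschitz_real_ae_almost_linear:
  fixes f :: "real \<Rightarrow> real"
  assumes f: "L-lipschitz_on UNIV f" and \<epsilon>: "\<epsilon> > 0"
  shows "negligible {x. \<not> (\<exists>q. \<exists>\<delta>>0. \<forall>t. \<bar>t\<bar> < \<delta> \<longrightarrow> \<bar>f (x + t) - f x - q * t\<bar> \<le> \<epsilon> * \<bar>t\<bar>)}"
proof -
  have L: "L \<ge> 0" using f lipschitz_on_nonneg by blast
  have lip: "\<bar>f x - f y\<bar> \<le> L * \<bar>x - y\<bar>" for x y
    using lipschitz_onD[OF f, of x y] by (simp add: dist_real_def)
  \<comment> \<open>The tilt moves slopes from [-L, L] to [1, 2 L + 1], so that \<open>g\<close> is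
    expanding as required for the existence of the density.\<close>
  define g where "g x = f x + (L + 1) * x" for x
  define M where "M = 2 * L + 1"
  have M: "M \<ge> 0" using L by (simp add: M_def)
  have g1: "y - x \<le> g y - g x" and g2: "g y - g x \<le> M * (y - x)" if "x \<le> y" for x y
    using lip[of y x] that by (auto simp: g_def M_def abs_le_iff algebra_simps)
  obtain h where h: "h \<in> borel_measurable borel"
    and int: "\<And>x y. x \<le> y \<Longrightarrow> (\<integral>\<^sup>+u\<in>{x..y}. h u \<partial>lborel) = ennreal (g y - g x)"
    using bilipschitz_density[OF g1 g2] by metis
  define S where "S a b = {x. ennreal a \<le> h x \<and> h x \<le> b}" for a b
  have Sb: "S a b \<in> sets borel" for a b unfolding S_def using h by measurable
  then have Sl: "S a b \<in> sets lebesgue" for a b by simp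
  have meas: "measure lebesgue (S a b \<inter> {x..y}) = measure lborel (S a b \<inter> {x..y})" for a b x y
    using Sb by (intro measure_completion) auto
  have meas_le: "measure lborel (S a b \<inter> {x..y}) \<le> y - x" if "x \<le> y" for a b x y
    using measure_mono_fmeasurable[of "S a b \<inter> {x..y}" "{x..y}" lborel] that Sb
    by (auto simp: fmeasurable_def)
  have lower: "a * measure lborel (S a b \<inter> {x..y}) \<le> g y - g x" if "x \<le> y" "0 \<le> a" for a b x y
    unfolding S_def using that g1[OF that(1)] by (intro nn_set_integral_lower[OF h int]) auto
  define bad where "bad S \<delta> = {x \<in> S. \<not> (\<exists>e>0. \<forall>t. 0 < t \<and> t < e \<longrightarrow>
     (1 - \<delta>) * t \<le> measure lebesgue (S \<inter> {x..x+t}) \<and> (1 - \<delta>) * t \<le> measure lebesgue (S \<inter> {x-t..x}))}"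
    for S :: "real set" and \<delta> :: real
  have bad: "negligible (bad (S a b) \<delta>)" if "\<delta> > 0" for a b \<delta>
    unfolding bad_def using negligible_not_one_sided_density[OF Sl that] .
  \<comment> \<open>At a density point of the set where \<open>h\<close> is at least some c > M,
    \<open>g\<close> would grow faster than its upper slope bound \<open>M\<close> allows.\<close>
  have big: "negligible (S (M + 1 / Suc n) top)" for n
  proof (rule negligible_subset[OF bad])
    define c where "c = M + 1 / Suc n"
    have c: "c > M" "c > 0" using M by (auto simp: c_def add_nonneg_pos)
    \<comment> \<open>This choice makes \<open>c * (1 - \<delta>)\<close> the midpoint of
      \<open>M\<close> and \<open>c\<close>.\<close>
    define \<delta> where "\<delta> = (c - M) / (2 * c)"
    show \<delta>: "\<delta> > 0" using c by (simp add: \<delta>_def)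
    have "c * (1 - \<delta>) = (c + M) / 2" using c by (simp add: \<delta>_def field_simps)
    then have cM: "c * (1 - \<delta>) > M" using c by simp
    show "S (M + 1 / Suc n) top \<subseteq> bad (S (M + 1 / Suc n) top) \<delta>"
    proof (rule subsetI, rule ccontr)
      fix x assume x: "x \<in> S (M + 1 / Suc n) top" "x \<notin> bad (S (M + 1 / Suc n) top) \<delta>"
      then obtain e where e: "e > 0" "\<And>t. 0 < t \<Longrightarrow> t < e \<Longrightarrow> (1 - \<delta>) * t \<le> measure lebesgue (S c top \<inter> {x..x+t})"
        unfolding bad_def c_def[symmetric] by auto
      define t where "t = e/2"
      have t: "0 < t" "t < e" using e by (auto simp: t_def)
      have "M * t < c * (1 - \<delta>) * t" using cM t by simp
      also have "\<dots> = c * ((1 - \<delta>) * t)" by simp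
      also have "\<dots> \<le> c * measure lborel (S c top \<inter> {x..x+t})"
        using e(2)[OF t] c by (intro mult_left_mono) (auto simp: meas)
      also have "\<dots> \<le> g (x+t) - g x" using t c by (intro lower) auto
      also have "\<dots> \<le> M * t" using g2[of x "x+t"] t by simp
      finally show False by simp
    qed
  qed
  have "negligible (\<Union>n. S (M + 1 / Suc n) top)"
    using big by (intro negligible_countable_Union) auto
  moreover have "(\<Union>n. S (M + 1 / Suc n) top) = {x. \<not> h x \<le> ennreal M}"
  proof (intro set_eqI iffI)
    fix x assume "x \<in> (\<Union>n. S (M + 1 / Suc n) top)"
    then obtain n where "ennreal (M + 1 / Suc n) \<le> h x" by (auto simp: S_def)
    moreover have "ennreal M < ennreal (M + 1 / Suc n)" using M by (simp add: ennreal_less_iff)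
    ultimately show "x \<in> {x. \<not> h x \<le> ennreal M}" by (simp add: not_le order_less_le_trans)
  next
    fix x assume x: "x \<in> {x. \<not> h x \<le> ennreal M}"
    show "x \<in> (\<Union>n. S (M + 1 / Suc n) top)"
    proof (cases "h x")
      case (real r)
      then have "M < r" using x M by (auto simp: not_le ennreal_less_iff)
      then obtain n where "1 / Suc n < r - M" using nat_approx_posE[of "r - M"] by auto
      then have "ennreal (M + 1 / Suc n) \<le> h x" unfolding real using M by (intro ennreal_leI) simp
      then show ?thesis by (auto simp: S_def)
    qed (auto simp: S_def)
  qed
  ultimately have neg: "negligible {x. \<not> h x \<le> ennreal M}" by simp
  have "{x. \<not> h x \<le> ennreal M} \<in> null_sets lebesgue" using neg by (simp add: negligible_iff_null_sets)
  moreover have "{x. \<not> h x \<le> ennreal M} \<in> sets borel" using h by measurable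
  ultimately have "{x. \<not> h x \<le> ennreal M} \<in> null_sets lborel" by (simp add: null_sets_completion_iff)
  then have ae: "AE x in lborel. h x \<le> ennreal M" by (rule AE_I'[of _ lborel]) auto
  have upper: "g y - g x \<le> b * measure lborel (S a (ennreal b) \<inter> {x..y}) + M * ((y - x) - measure lborel (S a (ennreal b) \<inter> {x..y}))"
    if "x \<le> y" "0 \<le> b" for a b x y
    using nn_set_integral_upper[OF h int[OF that(1)], of b M] g1[OF that(1)] that M ae by (simp add: S_def)
  define e where "e = \<epsilon> / 2"
  have e: "e > 0" using \<epsilon> by (simp add: e_def)
  \<comment> \<open>Closed slices of width \<open>e\<close> that overlap only in end values, so that
    every finite value of \<open>h\<close> falls into one.\<close>
  define T where "T k = S (real k * e) (ennreal ((real k + 1) * e))" for k :: nat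
  \<comment> \<open>The permitted gap shrinks with \<open>k\<close>: multiplied by the slice value k
    e or by \<open>M\<close> it stays at most \<open>e\<close>.\<close>
  define \<delta> where "\<delta> k = e / (M + real k * e + 1)" for k :: nat
  have pos: "M + real k * e + 1 > 0" for k using M e by (simp add: add_nonneg_pos)
  have \<delta>: "\<delta> k > 0" for k using pos[of k] e by (simp add: \<delta>_def)
  have \<delta>1: "real k * e * \<delta> k \<le> e" "M * \<delta> k \<le> e" for k
    using M e pos[of k] by (auto simp: \<delta>_def field_simps)
  \<comment> \<open>Per unit length, the gap costs \<open>e\<close> in the lower bound, while the
    gap and the slice width cost \<open>e\<close> each in the upper one; 2 e is
    \<open>\<epsilon>\<close>.\<close>
  have est: "\<bar>(g y - g x) - real k * e * (y - x)\<bar> \<le> \<epsilon> * (y - x)" 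
    if xy: "x \<le> y" and m: "(1 - \<delta> k) * (y - x) \<le> measure lebesgue (T k \<inter> {x..y})" for x y k
  proof -
    define m where "m = measure lborel (T k \<inter> {x..y})"
    have m: "(1 - \<delta> k) * (y - x) \<le> m" "m \<le> y - x" 
      using m meas_le[OF xy] by (auto simp: m_def T_def meas)
    have l: "real k * e * m \<le> g y - g x" unfolding m_def T_def using e xy by (intro lower) auto
    have u: "g y - g x \<le> (real k + 1) * e * m + M * ((y - x) - m)" 
      unfolding m_def T_def using e xy by (intro upper) auto
    define K where "K = real k * e"
    define D where "D = y - x"
    have D: "D \<ge> 0" using xy by (simp add: D_def)
    have "K * ((1 - \<delta> k) * D) \<le> K * m" unfolding K_def D_def using m e by (intro mult_left_mono) auto
    moreover have "K * \<delta> k * D \<le> e * D" using \<delta>1 D unfolding K_def by (intro mult_right_mono) auto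
    ultimately have 1: "K * D - e * D \<le> K * m" by (simp add: algebra_simps)
    have "(K + e) * m \<le> (K + e) * D" unfolding K_def D_def using m e by (intro mult_left_mono) auto
    moreover have "M * (D - m) \<le> M * (\<delta> k * D)"
      unfolding D_def using m M by (intro mult_left_mono) (auto simp: algebra_simps)
    moreover have "M * \<delta> k * D \<le> e * D" using \<delta>1 D by (intro mult_right_mono) auto
    ultimately have 2: "(K + e) * m + M * (D - m) \<le> K * D + e * D + e * D" by (simp add: algebra_simps)
    have 3: "e * D \<ge> 0" using e D by auto
    have "\<bar>(g y - g x) - K * D\<bar> \<le> e * D + e * D" 
      using l u 1 2 3 unfolding K_def[symmetric] D_def[symmetric] distrib_right[of _ _ e] mult_1
      by linarith
    also have "e * D + e * D = \<epsilon> * D" by (simp add: e_def)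
    finally show ?thesis by (simp add: K_def D_def)
  qed
  have "negligible ({x. \<not> h x \<le> ennreal M} \<union> (\<Union>k. bad (T k) (\<delta> k)))"
    using neg bad \<delta> by (intro negligible_Un negligible_countable_Union) (auto simp: T_def)
  moreover have "x \<notin> {x. \<not> (\<exists>q. \<exists>\<delta>>0. \<forall>t. \<bar>t\<bar> < \<delta> \<longrightarrow> \<bar>f (x + t) - f x - q * t\<bar> \<le> \<epsilon> * \<bar>t\<bar>)}"
    if "x \<notin> {x. \<not> h x \<le> ennreal M} \<union> (\<Union>k. bad (T k) (\<delta> k))" for x
  proof -
    from that have "x \<notin> {x. \<not> h x \<le> ennreal M} \<union> (\<Union>k. bad (T k) (\<delta> k))" .
    then have hx: "h x \<le> ennreal M" and nb: "\<And>k. x \<notin> bad (T k) (\<delta> k)" by auto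
    obtain H where H: "h x = ennreal H" "H \<ge> 0" using hx by (cases "h x") (auto simp: top_unique)
    define k where "k = nat \<lfloor>H / e\<rfloor>"
    have "real k \<le> H / e" "H / e \<le> real k + 1" using H e by (auto simp: k_def)
    then have "real k * e \<le> H" "H \<le> (real k + 1) * e" using e by (auto simp: field_simps)
    then have "x \<in> T k" using H e by (auto simp: T_def S_def ennreal_leI)
    then obtain d where d: "d > 0" "\<And>t. 0 < t \<Longrightarrow> t < d \<Longrightarrow>
       (1 - \<delta> k) * t \<le> measure lebesgue (T k \<inter> {x..x+t}) \<and> (1 - \<delta> k) * t \<le> measure lebesgue (T k \<inter> {x-t..x})"
      using nb[of k] unfolding bad_def by auto
    have "\<bar>f (x + t) - f x - (real k * e - (L + 1)) * t\<bar> \<le> \<epsilon> * \<bar>t\<bar>" if t: "\<bar>t\<bar> < d" for t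
    proof -
      \<comment> \<open>Removing the tilt turns the slope k e of \<open>g\<close> into the slope k e
        - (L + 1) of \<open>f\<close>.\<close>
      have eq: "f (x + t) - f x - (real k * e - (L + 1)) * t = g (x + t) - g x - real k * e * t"
        by (simp add: g_def algebra_simps)
      consider "t = 0" | "t > 0" | "t < 0" by linarith
      then show ?thesis
      proof cases
        case 1 then show ?thesis by simp
      next
        case 2 then show ?thesis unfolding eq using est[of x "x+t" k] d(2)[of t] t by auto
      next
        case 3 then show ?thesis unfolding eq using est[of "x+t" x k] d(2)[of "-t"] t by (auto simp: abs_if split: if_splits)
      qed
    qed
    then show ?thesis using d(1) by blast
  qed
  ultimately show ?thesis by (elim negligible_subset) blast
qed

section \<open>Rademacher's theorem\<close>

text \<open>Allows a slope to be replaced by a nearby one from a countable dense set, at the cost of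
  doubling the tolerance.\<close>

lemma abs_slope_perturb:
  fixes a q q' t :: real
  assumes "\<bar>a - q * t\<bar> \<le> e/2 * \<bar>t\<bar>" "\<bar>q - q'\<bar> \<le> e/2"
  shows "\<bar>a - q' * t\<bar> \<le> e * \<bar>t\<bar>"
proof -
  have "\<bar>q - q'\<bar> * \<bar>t\<bar> \<le> e/2 * \<bar>t\<bar>" using assms by (intro mult_right_mono) auto
  then have "\<bar>(q - q') * t\<bar> \<le> e/2 * \<bar>t\<bar>" by (simp add: abs_mult)
  moreover have "a - q' * t = (a - q * t) + (q - q') * t" by (simp add: algebra_simps)
  ultimately show ?thesis using assms(1) by linarith
qed

text \<open>Fubini in an arbitrary direction without a change of coordinates: all translates of
  \<open>N\<close> along \<open>e\<close> have the same measure, and exchanging the integrals in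
  their average leaves integrals over lines, which vanish.\<close>

lemma negligible_if_lines_negligible:
  fixes N :: "'a::euclidean_space set"
  assumes N: "N \<in> sets borel" and lines: "\<And>x. negligible {t::real. x + t *\<^sub>R e \<in> N}"
  shows "negligible N"
proof -
  \<comment> \<open>The cut-off to an interval of length 1 makes the average over t of the constant
    \<open>emeasure lborel N\<close> equal to that constant.\<close>
  define f :: "real \<times> 'a \<Rightarrow> ennreal" where "f = (\<lambda>(t, x). indicator N (x + t *\<^sub>R e) * indicator {0..1} t)"
  have f[measurable]: "f \<in> borel_measurable (lborel \<Otimes>\<^sub>M lborel)"
    unfolding f_def using N by (simp add: split_beta') measurable
  have tr: "emeasure lborel {x. x + t *\<^sub>R e \<in> N} = emeasure lborel N" for t
  proof -
    have "emeasure lborel N = emeasure (distr lborel borel ((+) (t *\<^sub>R e))) N"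
      by (simp add: lborel_distr_plus)
    also have "\<dots> = emeasure lborel {x. x + t *\<^sub>R e \<in> N}"
      using N by (subst emeasure_distr) (auto simp: vimage_def add.commute)
    finally show ?thesis ..
  qed
  have meas_tr: "{x. x + t *\<^sub>R e \<in> N} \<in> sets borel" for t
    using N by measurable
  have "(\<integral>\<^sup>+t. (\<integral>\<^sup>+x. f (t, x) \<partial>lborel) \<partial>lborel) = (\<integral>\<^sup>+t. emeasure lborel N * indicator {0..1::real} t \<partial>lborel)"
  proof (intro nn_integral_cong)
    fix t :: real
    have "(\<integral>\<^sup>+x. f (t, x) \<partial>lborel) = (\<integral>\<^sup>+x. indicator {0..1} t * indicator {x. x + t *\<^sub>R e \<in> N} x \<partial>lborel)"
      unfolding f_def by (intro nn_integral_cong) (auto simp: indicator_def)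
    also have "\<dots> = indicator {0..1} t * emeasure lborel {x. x + t *\<^sub>R e \<in> N}"
      using meas_tr by (intro nn_integral_cmult_indicator) simp
    finally show "(\<integral>\<^sup>+x. f (t, x) \<partial>lborel) = emeasure lborel N * indicator {0..1::real} t" 
      by (simp add: tr mult.commute)
  qed
  also have "\<dots> = emeasure lborel N" by (simp add: nn_integral_cmult_indicator)
  finally have 1: "(\<integral>\<^sup>+t. (\<integral>\<^sup>+x. f (t, x) \<partial>lborel) \<partial>lborel) = emeasure lborel N" .
  have "(\<integral>\<^sup>+x. (\<integral>\<^sup>+t. f (t, x) \<partial>lborel) \<partial>lborel) = (\<integral>\<^sup>+(x::'a). 0 \<partial>lborel)"
  proof (intro nn_integral_cong)
    fix x :: 'a
    have "{t::real. x + t *\<^sub>R e \<in> N} \<in> sets borel" using N by measurable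
    moreover have "{t::real. x + t *\<^sub>R e \<in> N} \<in> null_sets lebesgue"
      using lines by (simp add: negligible_iff_null_sets)
    ultimately have null: "{t::real. x + t *\<^sub>R e \<in> N} \<in> null_sets lborel"
      by (simp add: null_sets_completion_iff)
    have "(\<integral>\<^sup>+t. f (t, x) \<partial>lborel) = (\<integral>\<^sup>+(t::real). 0 \<partial>lborel)"
      by (rule nn_integral_cong_AE, rule AE_I'[OF null]) (auto simp: f_def indicator_def)
    then show "(\<integral>\<^sup>+t. f (t, x) \<partial>lborel) = 0" by simp
  qed
  then have "(\<integral>\<^sup>+x. (\<integral>\<^sup>+t. f (t, x) \<partial>lborel) \<partial>lborel) = 0" by simp
  then have "emeasure lborel N = 0"
    using 1 lborel_pair.Fubini'[of "\<lambda>t x. f (t, x)"] by simp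
  then have "N \<in> null_sets lborel" using N by auto
  then show ?thesis by (simp add: negligible_iff_null_sets null_sets_completionI)
qed

text \<open>Fubini asks for a Borel set. Rational slopes and radii \<open>1 / Suc m\<close> give a
  countable union of closed sets of good points, whose complement is Borel and, by the one-variable
  result, null on every line.\<close>

lemma lipschitz_ae_directional:
  fixes f :: "'a::euclidean_space \<Rightarrow> real"
  assumes f: "L-lipschitz_on UNIV f" and \<epsilon>: "\<epsilon> > 0" 
  shows "negligible {x. \<not> (\<exists>q. \<exists>\<delta>>0. \<forall>t. \<bar>t\<bar> < \<delta> \<longrightarrow> \<bar>f (x + t *\<^sub>R e) - f x - q * t\<bar> \<le> \<epsilon> * \<bar>t\<bar>)}"
proof -
  have L: "L \<ge> 0" using f lipschitz_on_nonneg by blast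
  have contf: "continuous_on UNIV f" using f lipschitz_on_continuous_on by blast
  define S where "S q m = {x. \<forall>t. \<bar>t\<bar> < 1 / Suc m \<longrightarrow> \<bar>f (x + t *\<^sub>R e) - f x - q * t\<bar> \<le> \<epsilon> * \<bar>t\<bar>}" for q m
  have "closed (S q m)" for q m
  proof -
    have "closed {x. \<bar>f (x + t *\<^sub>R e) - f x - q * t\<bar> \<le> \<epsilon> * \<bar>t\<bar>}" for t
      by (intro closed_Collect_le continuous_intros continuous_on_subset[OF contf] continuous_on_compose2[OF contf]) auto
    moreover have "S q m = (\<Inter>t\<in>{t. \<bar>t\<bar> < 1 / Suc m}. {x. \<bar>f (x + t *\<^sub>R e) - f x - q * t\<bar> \<le> \<epsilon> * \<bar>t\<bar>})"
      by (auto simp: S_def)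
    ultimately show ?thesis by (simp add: closed_INT)
  qed
  then have Sb: "S q m \<in> sets borel" for q m by simp
  define N where "N = - (\<Union>q\<in>\<rat>. \<Union>m. S q m)"
  have "N \<in> sets borel" unfolding N_def using Sb
    by (intro borel_comp sets.countable_UN'[OF countable_rat] sets.countable_UN) auto
  then have "negligible N"
  proof (rule negligible_if_lines_negligible)
    fix x :: 'a
    define g where "g s = f (x + s *\<^sub>R e)" for s
    have "(L * norm e)-lipschitz_on UNIV g"
    proof (rule lipschitz_onI)
      fix s t :: real
      have "dist (g s) (g t) \<le> L * dist (x + s *\<^sub>R e) (x + t *\<^sub>R e)"
        unfolding g_def by (rule lipschitz_onD[OF f]) auto
      also have "dist (x + s *\<^sub>R e) (x + t *\<^sub>R e) = dist s t * norm e"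
        by (simp add: dist_norm scaleR_diff_left[symmetric])
      finally show "dist (g s) (g t) \<le> L * norm e * dist s t" by (simp add: mult_ac)
    qed (use L in auto)
    then have "negligible {s. \<not> (\<exists>q. \<exists>\<delta>>0. \<forall>t. \<bar>t\<bar> < \<delta> \<longrightarrow> \<bar>g (s + t) - g s - q * t\<bar> \<le> \<epsilon>/2 * \<bar>t\<bar>)}"
      using \<epsilon> by (intro lipschitz_real_ae_almost_linear) auto
    then show "negligible {s. x + s *\<^sub>R e \<in> N}"
    proof (rule negligible_subset, intro subsetI CollectI notI)
      fix s assume s: "s \<in> {s. x + s *\<^sub>R e \<in> N}" 
      assume "\<exists>q. \<exists>\<delta>>0. \<forall>t. \<bar>t\<bar> < \<delta> \<longrightarrow> \<bar>g (s + t) - g s - q * t\<bar> \<le> \<epsilon>/2 * \<bar>t\<bar>"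
      then obtain q \<delta> where q: "\<delta> > 0" "\<And>t. \<bar>t\<bar> < \<delta> \<Longrightarrow> \<bar>g (s + t) - g s - q * t\<bar> \<le> \<epsilon>/2 * \<bar>t\<bar>" by blast
      \<comment> \<open>Half of the tolerance was reserved for moving the slope to a rational
        one.\<close>
      obtain q' where q': "q' \<in> \<rat>" "q < q'" "q' < q + \<epsilon>/2"
        using Rats_dense_in_real[of q "q + \<epsilon>/2"] \<epsilon> by auto
      obtain m where m: "1 / Suc m < \<delta>" using nat_approx_posE[OF q(1)] by blast
      have "x + s *\<^sub>R e \<in> S q' m"
        unfolding S_def
      proof (intro CollectI allI impI)
        fix t :: real assume "\<bar>t\<bar> < 1 / Suc m"
        then have "\<bar>g (s + t) - g s - q * t\<bar> \<le> \<epsilon>/2 * \<bar>t\<bar>" using q m by auto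
        then have "\<bar>g (s + t) - g s - q' * t\<bar> \<le> \<epsilon> * \<bar>t\<bar>"
          by (rule abs_slope_perturb) (use q' in auto)
        then show "\<bar>f (x + s *\<^sub>R e + t *\<^sub>R e) - f (x + s *\<^sub>R e) - q' * t\<bar> \<le> \<epsilon> * \<bar>t\<bar>"
          by (simp add: g_def scaleR_add_left add.assoc)
      qed
      then show False using s q' by (auto simp: N_def)
    qed
  qed
  then show ?thesis
  proof (rule negligible_subset)
    show "{x. \<not> (\<exists>q. \<exists>\<delta>>0. \<forall>t. \<bar>t\<bar> < \<delta> \<longrightarrow> \<bar>f (x + t *\<^sub>R e) - f x - q * t\<bar> \<le> \<epsilon> * \<bar>t\<bar>)} \<subseteq> N"
    proof (intro subsetI, rule ccontr)
      fix x assume x: "x \<in> {x. \<not> (\<exists>q. \<exists>\<delta>>0. \<forall>t. \<bar>t\<bar> < \<delta> \<longrightarrow> \<bar>f (x + t *\<^sub>R e) - f x - q * t\<bar> \<le> \<epsilon> * \<bar>t\<bar>)}" "x \<notin> N"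
      then obtain q m where "x \<in> S q m" by (auto simp: N_def)
      then have "\<forall>t. \<bar>t\<bar> < 1 / Suc m \<longrightarrow> \<bar>f (x + t *\<^sub>R e) - f x - q * t\<bar> \<le> \<epsilon> * \<bar>t\<bar>" "1 / Suc m > (0::real)"
        unfolding S_def by auto
      then show False using x(1) by blast
    qed
  qed
qed

text \<open>The increment of \<open>f\<close> from \<open>x\<close> to \<open>x + v\<close> is estimated along the coordinate directions in turn;
  before each step the current point is replaced by a nearby point of \<open>S\<close>, which is possible
  as \<open>S\<close> is not porous at \<open>x\<close>.\<close>

lemma almost_linear_at_nonporous_point:
  fixes f :: "'a::euclidean_space \<Rightarrow> real"
  assumes f: "L-lipschitz_on UNIV f" and \<epsilon>: "\<epsilon> > 0" and r: "r > 0" and x: "x \<in> S"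
    and S: "\<And>s e t. s \<in> S \<Longrightarrow> e \<in> Basis \<Longrightarrow> \<bar>t\<bar> < r \<Longrightarrow> \<bar>f (s + t *\<^sub>R e) - f s - (p \<bullet> e) * t\<bar> \<le> \<epsilon> * \<bar>t\<bar>"
    and \<eta>: "L * \<eta> \<le> \<epsilon>" 
    and np: "\<And>z. z \<noteq> x \<Longrightarrow> dist x z < r \<Longrightarrow> S \<inter> ball z (\<eta> * dist x z) \<noteq> {}"
    and v: "norm v < r"
  shows "\<bar>f (x + v) - f x - p \<bullet> v\<bar> \<le> real DIM('a) * (3 * \<epsilon>) * norm v"
proof -
  have lip: "\<bar>f a - f b\<bar> \<le> L * norm (a - b)" for a b
    using lipschitz_onD[OF f, of a b] by (simp add: dist_real_def dist_norm)
  have L: "L \<ge> 0" using f lipschitz_on_nonneg by blast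
  \<comment> \<open>The part of \<open>v\<close> in the coordinates \<open>A\<close>. It is no
    longer than \<open>v\<close>, so all intermediate points \<open>x + w A\<close> stay within
    distance \<open>r\<close> of \<open>x\<close>.\<close>
  define w where "w A = (\<Sum>e\<in>A. (v \<bullet> e) *\<^sub>R e)" for A
  have wv: "norm (w A) \<le> norm v" if "A \<subseteq> Basis" for A
  proof (rule norm_le_componentwise)
    fix b :: 'a assume b: "b \<in> Basis"
    have "w A \<bullet> b = (\<Sum>e\<in>A. if e = b then v \<bullet> b else 0)"
      unfolding w_def inner_sum_left using that b by (intro sum.cong) (auto simp: inner_Basis subset_iff)
    also have "\<dots> = (if b \<in> A then v \<bullet> b else 0)"
      using finite_subset[OF that finite_Basis] by (simp add: sum.delta)
    finally show "\<bar>w A \<bullet> b\<bar> \<le> \<bar>v \<bullet> b\<bar>" by auto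
  qed
  have "finite A \<Longrightarrow> A \<subseteq> Basis \<Longrightarrow> \<bar>f (x + w A) - f x - p \<bullet> w A\<bar> \<le> real (card A) * (3 * \<epsilon>) * norm v" for A
  proof (induction A rule: finite_induct)
    case empty then show ?case by (simp add: w_def)
  next
    case (insert e A)
    have e: "e \<in> Basis" and A: "A \<subseteq> Basis" using insert.prems by auto
    define t where "t = v \<bullet> e"
    have t: "\<bar>t\<bar> \<le> norm v" using Basis_le_norm[OF e, of v] by (simp add: t_def)
    have wi: "w (insert e A) = w A + t *\<^sub>R e" using insert.hyps by (simp add: w_def t_def add.commute)
    obtain s where s: "s \<in> S" "L * norm (x + w A - s) \<le> \<epsilon> * norm v"
    \<comment> \<open>Non-porosity speaks only of points other than \<open>x\<close>; at
      \<open>x\<close> itself, \<open>x\<close> serves as the point of \<open>S\<close>.\<close>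
    proof (cases "w A = 0")
      case True then show ?thesis using that[OF x] \<epsilon> by simp
    next
      case False
      have "dist x (x + w A) < r" using wv[OF A] v by (simp add: dist_norm)
      then obtain s where s: "s \<in> S" "dist (x + w A) s < \<eta> * dist x (x + w A)"
        using np[of "x + w A"] False by auto
      have "L * norm (x + w A - s) \<le> L * (\<eta> * norm (w A))"
        using s L by (intro mult_left_mono) (auto simp: dist_norm)
      also have "\<dots> = (L * \<eta>) * norm (w A)" by simp
      also have "\<dots> \<le> \<epsilon> * norm v" using \<eta> wv[OF A] \<epsilon> by (intro mult_mono) auto
      finally show ?thesis using that s by blast
    qed
    \<comment> \<open>Moving each of the two end points of the step to \<open>s\<close> costs
      \<epsilon> |v|, and so does the slope error at \<open>s\<close>; hence
      \<open>3 * \<epsilon>\<close> per coordinate.\<close>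
    have "\<bar>f (x + w A + t *\<^sub>R e) - f (s + t *\<^sub>R e)\<bar> \<le> L * norm (x + w A - s)"
      using lip[of "x + w A + t *\<^sub>R e" "s + t *\<^sub>R e"] by simp
    moreover have "\<bar>f (x + w A) - f s\<bar> \<le> L * norm (x + w A - s)" by (rule lip)
    moreover have "\<bar>f (s + t *\<^sub>R e) - f s - (p \<bullet> e) * t\<bar> \<le> \<epsilon> * \<bar>t\<bar>" using S[OF s(1) e] t v by simp
    moreover have "\<epsilon> * \<bar>t\<bar> \<le> \<epsilon> * norm v" using t \<epsilon> by simp
    moreover have "p \<bullet> w (insert e A) = p \<bullet> w A + (p \<bullet> e) * t" by (simp add: wi inner_add_right)
    ultimately have "\<bar>f (x + w (insert e A)) - f x - p \<bullet> w (insert e A)\<bar>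
        \<le> \<bar>f (x + w A) - f x - p \<bullet> w A\<bar> + 3 * (\<epsilon> * norm v)"
      using s(2) unfolding wi add.assoc[symmetric] by linarith
    also have "\<bar>f (x + w A) - f x - p \<bullet> w A\<bar> \<le> real (card A) * (3 * \<epsilon>) * norm v" by (rule insert.IH[OF A])
    finally show ?case using insert.hyps by (simp add: algebra_simps)
  qed
  from this[of Basis] show ?thesis by (simp add: w_def euclidean_representation)
qed

text \<open>With \<open>p\<close> from a countable dense set there are only countably many closed
  sets \<open>S p m\<close>, so their porous points together form a null set. Any other point with
  good coordinate slopes is a non-porous point of some \<open>S p m\<close>.\<close>

lemma lipschitz_ae_almost_linear:
  fixes f :: "'a::euclidean_space \<Rightarrow> real"
  assumes f: "L-lipschitz_on UNIV f" and \<epsilon>0: "\<epsilon>\<^sub>0 > 0" 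
  shows "negligible {x. \<not> (\<exists>p. \<exists>\<delta>>0. \<forall>v. norm v < \<delta> \<longrightarrow> \<bar>f (x + v) - f x - p \<bullet> v\<bar> \<le> \<epsilon>\<^sub>0 * norm v)}"
    (is "negligible ?B")
proof -
  have L: "L \<ge> 0" using f lipschitz_on_nonneg by blast
  have contf: "continuous_on UNIV f" using f lipschitz_on_continuous_on by blast
  \<comment> \<open>Compensates for the factor \<open>3 * DIM('a)\<close> of the coordinatewise
    estimate.\<close>
  define \<epsilon> where "\<epsilon> = \<epsilon>\<^sub>0 / (3 * real DIM('a))"
  have \<epsilon>: "\<epsilon> > 0" "real DIM('a) * (3 * \<epsilon>) = \<epsilon>\<^sub>0" using \<epsilon>0 by (auto simp: \<epsilon>_def)
  \<comment> \<open>The 1 in the denominator covers the case L = 0.\<close>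
  define \<eta> where "\<eta> = \<epsilon> / (L + 1)"
  have \<eta>: "\<eta> > 0" "L * \<eta> \<le> \<epsilon>" using L \<epsilon> by (auto simp: \<eta>_def field_simps)
  obtain D :: "'a set" where D: "countable D" "\<And>X. open X \<Longrightarrow> X \<noteq> {} \<Longrightarrow> \<exists>d\<in>D. d \<in> X"
    using countable_dense_setE by metis
  define S where "S p m = {x. \<forall>e\<in>Basis. \<forall>t. \<bar>t\<bar> < 1 / Suc m \<longrightarrow> \<bar>f (x + t *\<^sub>R e) - f x - (p \<bullet> e) * t\<bar> \<le> \<epsilon> * \<bar>t\<bar>}" for p m
  have closed: "closed (S p m)" for p m
  proof -
    have "closed {x. \<bar>f (x + t *\<^sub>R e) - f x - (p \<bullet> e) * t\<bar> \<le> \<epsilon> * \<bar>t\<bar>}" for e t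
      by (intro closed_Collect_le continuous_intros continuous_on_subset[OF contf] continuous_on_compose2[OF contf]) auto
    moreover have "S p m = (\<Inter>e\<in>Basis. \<Inter>t\<in>{t. \<bar>t\<bar> < 1 / Suc m}. {x. \<bar>f (x + t *\<^sub>R e) - f x - (p \<bullet> e) * t\<bar> \<le> \<epsilon> * \<bar>t\<bar>})"
      by (auto simp: S_def)
    ultimately show ?thesis by (simp add: closed_INT)
  qed
  define Por where "Por p m = {x \<in> S p m. \<forall>r>0. \<exists>z. z \<noteq> x \<and> dist x z < r \<and> S p m \<inter> ball z (\<eta> * dist x z) = {}}" for p m
  have Por: "negligible (Por p m)" for p m
    unfolding Por_def using closed \<eta> by (intro negligible_porous) auto
  define N where "N e = {x. \<not> (\<exists>q. \<exists>\<delta>>0. \<forall>t. \<bar>t\<bar> < \<delta> \<longrightarrow> \<bar>f (x + t *\<^sub>R e) - f x - q * t\<bar> \<le> \<epsilon>/2 * \<bar>t\<bar>)}" for e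
  have N: "negligible (N e)" for e
    unfolding N_def using \<epsilon> by (intro lipschitz_ae_directional[OF f]) auto
  have "negligible ((\<Union>e\<in>Basis. N e) \<union> (\<Union>p\<in>D. \<Union>m. Por p m))"
    using N Por D(1) by (intro negligible_Un negligible_countable_Union) (auto simp: countable_finite)
  then show ?thesis
  proof (rule negligible_subset)
    have "x \<notin> ?B" if "x \<notin> (\<Union>e\<in>Basis. N e) \<union> (\<Union>p\<in>D. \<Union>m. Por p m)" for x
    proof -
      have "\<forall>e\<in>Basis. \<exists>q. \<exists>\<delta>>0. \<forall>t. \<bar>t\<bar> < \<delta> \<longrightarrow> \<bar>f (x + t *\<^sub>R e) - f x - q * t\<bar> \<le> \<epsilon>/2 * \<bar>t\<bar>"
        using that by (auto simp: N_def)
      then obtain q where "\<forall>e\<in>Basis. \<exists>\<delta>>0. \<forall>t. \<bar>t\<bar> < \<delta> \<longrightarrow> \<bar>f (x + t *\<^sub>R e) - f x - q e * t\<bar> \<le> \<epsilon>/2 * \<bar>t\<bar>"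
        by (rule bchoice[THEN exE])
      then obtain \<delta> where \<delta>: "\<forall>e\<in>Basis. \<delta> e > 0 \<and> (\<forall>t. \<bar>t\<bar> < \<delta> e \<longrightarrow> \<bar>f (x + t *\<^sub>R e) - f x - q e * t\<bar> \<le> \<epsilon>/2 * \<bar>t\<bar>)"
        by (rule bchoice[THEN exE])
      \<comment> \<open>The coordinates of \<open>p0\<close> are the directional slopes. Its
        neighbour \<open>p\<close> in the dense set changes each of them by at most
        \<open>\<epsilon>/2\<close>.\<close>
      define p0 where "p0 = (\<Sum>e\<in>Basis. q e *\<^sub>R e)"
      have p0: "p0 \<bullet> e = q e" if "e \<in> Basis" for e
        using that by (simp add: p0_def)
      obtain p where p: "p \<in> D" "dist p0 p < \<epsilon>/2" using D(2)[of "ball p0 (\<epsilon>/2)"] \<epsilon> by auto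
      define d where "d = Min (\<delta> ` Basis)"
      have d: "d > 0" "\<And>e. e \<in> Basis \<Longrightarrow> d \<le> \<delta> e" using \<delta> by (auto simp: d_def)
      obtain m where m: "1 / Suc m < d" using nat_approx_posE[OF d(1)] by blast
      have xS: "x \<in> S p m"
        unfolding S_def
      proof (intro CollectI ballI allI impI)
        fix e :: 'a and t :: real assume e: "e \<in> Basis" and "\<bar>t\<bar> < 1 / Suc m"
        then have "\<bar>f (x + t *\<^sub>R e) - f x - q e * t\<bar> \<le> \<epsilon>/2 * \<bar>t\<bar>" using \<delta> d(2)[OF e] m by auto
        moreover have "\<bar>(p0 - p) \<bullet> e\<bar> \<le> \<epsilon>/2" using Basis_le_norm[OF e, of "p0 - p"] p by (simp add: dist_norm)
        then have "\<bar>q e - p \<bullet> e\<bar> \<le> \<epsilon>/2" using p0[OF e] by (simp add: inner_diff_left)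
        ultimately show "\<bar>f (x + t *\<^sub>R e) - f x - (p \<bullet> e) * t\<bar> \<le> \<epsilon> * \<bar>t\<bar>"
          by (rule abs_slope_perturb)
      qed
      have "x \<notin> Por p m" using that p by auto
      then obtain \<rho> where \<rho>: "\<rho> > 0" "\<And>z. z \<noteq> x \<Longrightarrow> dist x z < \<rho> \<Longrightarrow> S p m \<inter> ball z (\<eta> * dist x z) \<noteq> {}"
        using xS unfolding Por_def by auto
      define r where "r = min \<rho> (1 / Suc m)"
      have r: "r > 0" using \<rho> by (simp add: r_def)
      have "\<bar>f (x + v) - f x - p \<bullet> v\<bar> \<le> \<epsilon>\<^sub>0 * norm v" if v: "norm v < r" for v
        unfolding \<epsilon>(2)[symmetric]
      proof (rule almost_linear_at_nonporous_point[OF f \<epsilon>(1) r xS _ \<eta>(2) _ v])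
        show "\<bar>f (s + t *\<^sub>R e) - f s - p \<bullet> e * t\<bar> \<le> \<epsilon> * \<bar>t\<bar>" if "s \<in> S p m" "e \<in> Basis" "\<bar>t\<bar> < r" for s e t
          using that unfolding S_def r_def by simp
        show "S p m \<inter> ball z (\<eta> * dist x z) \<noteq> {}" if "z \<noteq> x" "dist x z < r" for z
          using that \<rho>(2)[of z] by (simp add: r_def)
      qed
      then show ?thesis using r by blast
    qed
    then show "?B \<subseteq> (\<Union>e\<in>Basis. N e) \<union> (\<Union>p\<in>D. \<Union>m. Por p m)" by blast
  qed
qed

text \<open>Almost every point has an approximate gradient for each tolerance
  \<open>1 / Suc n\<close>. Any two of these describe the same small increments, so they form a
  Cauchy sequence, whose limit is the gradient.\<close>

theorem rademacher:
  fixes f :: "'a::euclidean_space \<Rightarrow> real"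
  assumes f: "L-lipschitz_on UNIV f"
  shows "negligible {x. \<not> f differentiable (at x)}"
proof -
  define B where "B n = {x. \<not> (\<exists>p. \<exists>\<delta>>0. \<forall>v. norm v < \<delta> \<longrightarrow> \<bar>f (x + v) - f x - p \<bullet> v\<bar> \<le> (1 / Suc n) * norm v)}" for n
  have "negligible (B n)" for n
    unfolding B_def by (rule lipschitz_ae_almost_linear[OF f]) simp
  then have "negligible (\<Union>n. B n)" by (intro negligible_countable_Union) auto
  moreover have "f differentiable (at x)" if "x \<notin> (\<Union>n. B n)" for x
  proof -
    define e where "e n = 1 / real (Suc n)" for n
    have "\<forall>n. \<exists>p. \<exists>\<delta>>0. \<forall>v. norm v < \<delta> \<longrightarrow> \<bar>f (x + v) - f x - p \<bullet> v\<bar> \<le> e n * norm v"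
      using that by (auto simp: B_def e_def)
    then obtain p where "\<forall>n. \<exists>\<delta>>0. \<forall>v. norm v < \<delta> \<longrightarrow> \<bar>f (x + v) - f x - p n \<bullet> v\<bar> \<le> e n * norm v"
      by (rule choice[THEN exE])
    then obtain \<delta> where p: "\<And>n. \<delta> n > 0" "\<And>n v. norm v < \<delta> n \<Longrightarrow> \<bar>f (x + v) - f x - p n \<bullet> v\<bar> \<le> e n * norm v"
      by metis
    have diff: "norm (p m - p n) \<le> e m + e n" for m n
    proof (cases "p m = p n")
      case True then show ?thesis by (simp add: e_def)
    next
      case False
      \<comment> \<open>The difference of two approximate gradients is tested on a short vector
        parallel to it, where Cauchy-Schwarz is an equality.\<close>
      define u where "u = p m - p n"
      have u: "norm u > 0" using False by (simp add: u_def)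
      define s where "s = min (\<delta> m) (\<delta> n) / (2 * norm u)"
      define v where "v = s *\<^sub>R u"
      have s: "s > 0" using p(1)[of m] p(1)[of n] u by (simp add: s_def)
      have nv: "norm v = min (\<delta> m) (\<delta> n) / 2"
        using s u p(1)[of m] p(1)[of n] by (simp add: v_def s_def min_def)
      have "norm v < \<delta> m" "norm v < \<delta> n" using nv p(1)[of m] p(1)[of n] by auto
      then have "\<bar>u \<bullet> v\<bar> \<le> (e m + e n) * norm v"
        using p(2)[of v m] p(2)[of v n] by (simp add: u_def inner_diff_left algebra_simps)
      moreover have "u \<bullet> v = norm u * norm v" using s by (simp add: v_def dot_square_norm power2_eq_square)
      ultimately have "norm u * norm v \<le> (e m + e n) * norm v" by simp
      moreover have "norm v > 0" using u s by (simp add: v_def)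
      ultimately show ?thesis by (simp add: u_def)
    qed
    have e0: "e \<longlonglongrightarrow> 0" unfolding e_def by (rule LIMSEQ_Suc[OF lim_1_over_n])
    have "Cauchy p"
    proof (rule metric_CauchyI)
      fix c :: real assume "c > 0"
      then have "eventually (\<lambda>n. e n < c/2) sequentially"
        using order_tendstoD(2)[OF e0, of "c/2"] by simp
      then obtain M where "\<And>n. n \<ge> M \<Longrightarrow> e n < c/2" by (auto simp: eventually_sequentially)
      then have "dist (p m) (p n) < c" if "m \<ge> M" "n \<ge> M" for m n
        using diff[of m n] that by (smt (verit) dist_norm field_sum_of_halves)
      then show "\<exists>M. \<forall>m\<ge>M. \<forall>n\<ge>M. dist (p m) (p n) < c" by blast
    qed
    then obtain P where P: "p \<longlonglongrightarrow> P" using Cauchy_convergent convergent_def by blast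
    have diffP: "norm (p m - P) \<le> e m" for m
    proof (rule LIMSEQ_le)
      show "(\<lambda>n. norm (p m - p n)) \<longlonglongrightarrow> norm (p m - P)" by (intro tendsto_intros P)
      show "(\<lambda>n. e m + e n) \<longlonglongrightarrow> e m" using tendsto_add[OF tendsto_const e0] by simp
    qed (use diff in auto)
    have "(f has_derivative (\<lambda>v. P \<bullet> v)) (at x)"
      unfolding has_derivative_at_alt
    proof (intro conjI allI impI)
      show "bounded_linear (\<lambda>v. P \<bullet> v)" by (rule bounded_linear_inner_right)
      fix c :: real assume "0 < c"
      \<comment> \<open>Half of \<open>c\<close> pays for the error of \<open>p n\<close>, the other
        half for replacing \<open>p n\<close> by the limit \<open>P\<close>.\<close>
      then obtain n where n: "1 / Suc n < c/2" using nat_approx_posE[of "c/2"] by auto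
      show "\<exists>d>0. \<forall>y. norm (y - x) < d \<longrightarrow> norm (f y - f x - P \<bullet> (y - x)) \<le> c * norm (y - x)"
      proof (intro exI[of _ "\<delta> n"] conjI allI impI p(1))
        fix y assume y: "norm (y - x) < \<delta> n"
        have "\<bar>f y - f x - p n \<bullet> (y - x)\<bar> \<le> e n * norm (y - x)" using p(2)[OF y] by simp
        moreover have "\<bar>(p n - P) \<bullet> (y - x)\<bar> \<le> e n * norm (y - x)"
          by (rule order_trans[OF Cauchy_Schwarz_ineq2]) (intro mult_right_mono diffP, simp)
        moreover have "2 * e n * norm (y - x) \<le> c * norm (y - x)"
          using n by (intro mult_right_mono) (auto simp: e_def)
        ultimately show "norm (f y - f x - P \<bullet> (y - x)) \<le> c * norm (y - x)"
          by (simp add: inner_diff_left)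
      qed
    qed
    then show ?thesis by (auto simp: differentiable_def)
  qed
  ultimately show ?thesis by (elim negligible_subset) blast
qed

section \<open>Lipschitz extension and Rademacher's theorem on open sets\<close>

lemma mcshane_extension:
  fixes f :: "'a::metric_space \<Rightarrow> real"
  assumes f: "L-lipschitz_on S f"
  obtains g where "L-lipschitz_on UNIV g" "\<And>x. x \<in> S \<Longrightarrow> g x = f x"
proof (cases "S = {}")
  case True
  \<comment> \<open>An infimum over the empty set would be unspecified, so the zero function is
    taken here.\<close>
  have "L-lipschitz_on UNIV (\<lambda>x::'a. 0::real)" using lipschitz_on_nonneg[OF f] by (intro lipschitz_onI) auto
  then show ?thesis using that True by blast
next
  case False
  have L: "L \<ge> 0" using f lipschitz_on_nonneg by blast
  have lip: "\<bar>f x - f y\<bar> \<le> L * dist x y" if "x \<in> S" "y \<in> S" for x y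
    using lipschitz_onD[OF f that] by (simp add: dist_real_def)
  \<comment> \<open>The lower envelope of cones of slope \<open>L\<close> with vertices on the graph
    of \<open>f\<close>. Each cone is \<open>L\<close>-Lipschitz, hence so is the envelope; on
    \<open>S\<close> no cone falls below \<open>f\<close>.\<close>
  define g where "g x = (INF z\<in>S. f z + L * dist x z)" for x
  have bdd: "bdd_below ((\<lambda>z. f z + L * dist x z) ` S)" for x
  proof -
    obtain z0 where z0: "z0 \<in> S" using False by auto
    show ?thesis
    proof (rule bdd_belowI2)
      fix z assume z: "z \<in> S"
      have "L * dist z0 z \<le> L * (dist x z0 + dist x z)" using L dist_triangle3[of z0 z x] by (intro mult_left_mono) auto
      then show "f z0 - L * dist x z0 \<le> f z + L * dist x z" using lip[OF z0 z] by (simp add: algebra_simps abs_le_iff)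
    qed
  qed
  show ?thesis
  proof
    show "g x = f x" if x: "x \<in> S" for x
    proof (rule antisym)
      show "g x \<le> f x" unfolding g_def using cINF_lower[OF bdd x, of x] by simp
      show "f x \<le> g x" unfolding g_def
        using lip[OF x] by (intro cINF_greatest False) (force simp: abs_le_iff)
    qed
    have le: "g x \<le> g y + L * dist x y" for x y
    proof -
      have "g x - L * dist x y \<le> g y" unfolding g_def[of y]
      proof (rule cINF_greatest[OF False])
        fix z assume z: "z \<in> S"
        have "g x \<le> f z + L * dist x z" unfolding g_def by (rule cINF_lower[OF bdd z])
        moreover have "L * dist x z \<le> L * (dist x y + dist y z)" using L dist_triangle[of x z y] by (intro mult_left_mono) auto
        ultimately show "g x - L * dist x y \<le> f z + L * dist y z" by (simp add: algebra_simps)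
      qed
      then show ?thesis by simp
    qed
    show "L-lipschitz_on UNIV g"
    proof (rule lipschitz_onI[OF _ L])
      show "dist (g x) (g y) \<le> L * dist x y" for x y
        using le[of x y] le[of y x] by (auto simp: dist_real_def dist_commute abs_le_iff)
    qed
  qed
qed

corollary rademacher_open:
  fixes f :: "'a::euclidean_space \<Rightarrow> real"
  assumes f: "L-lipschitz_on S f" and S: "open S"
  shows "negligible {x \<in> S. \<not> f differentiable (at x)}"
proof -
  obtain g where g: "L-lipschitz_on UNIV g" "\<And>x. x \<in> S \<Longrightarrow> g x = f x"
    using mcshane_extension[OF f] by blast
  have "f differentiable (at x)" if "x \<in> S" "g differentiable (at x)" for x
    using that g(2) S unfolding differentiable_def by (metis has_derivative_transform_within_open)
  then show ?thesis by (intro negligible_subset[OF rademacher[OF g(1)]]) auto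
qed

section \<open>Hausdorff null sets from null cones\<close>

text \<open>A null set is covered by small non-overlapping cubes inside an open set of small volume,
  and for cubes the power \<open>DIM('a)\<close> of the diameter is a fixed multiple of the
  volume.\<close>

lemma negligible_cover_small_cubes:
  fixes C :: "'a::euclidean_space set"
  assumes neg: "negligible C" and bdd: "bounded C" and \<epsilon>: "\<epsilon> > 0" and \<delta>: "\<delta> > 0"
  obtains E :: "nat \<Rightarrow> 'a set" where "C \<subseteq> (\<Union>n. E n)" "\<And>n. bounded (E n)" "\<And>n. diameter (E n) \<le> \<delta>"
    "(\<Sum>n. ennreal (diameter (E n) ^ DIM('a))) \<le> ennreal \<epsilon>"
proof -
  \<comment> \<open>A cube of side s has diameter \<open>s * norm One\<close>, so \<open>k\<close>
    is that fixed multiple.\<close>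
  define k where "k = norm (One::'a) ^ DIM('a)"
  have k: "k > 0" by (simp add: k_def)
  obtain T where T: "open T" "C \<subseteq> T" "T - C \<in> lmeasurable" "emeasure lebesgue (T - C) < ennreal (\<epsilon> / k)"
    using sets_lebesgue_outer_open[of C "\<epsilon> / k"] negligible_imp_sets[OF neg] \<epsilon> k by auto
  have "emeasure lebesgue T = emeasure lebesgue (T - C)"
    using neg T by (intro emeasure_Diff_null_set[symmetric]) (auto simp: negligible_iff_null_sets)
  then have eT: "emeasure lborel T < ennreal (\<epsilon> / k)" using T(1,4) by simp
  obtain B where B: "B > 0" "C \<subseteq> ball 0 B"
    using bdd bounded_subset_ballD by blast
  \<comment> \<open>The enclosing box is itself a cube, which makes its dyadic pieces cubes.\<close>
  define a b :: 'a where "a = - (B *\<^sub>R One)" and "b = B *\<^sub>R One"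
  have Cab: "C \<subseteq> cbox a b"
  proof
    fix x assume "x \<in> C"
    then have "norm x < B" using B by auto
    then have "\<bar>x \<bullet> i\<bar> \<le> B" if "i \<in> Basis" for i using Basis_le_norm[OF that, of x] by linarith
    then show "x \<in> cbox a b" by (force simp: mem_box a_def b_def abs_le_iff)
  qed
  have box: "box a b \<noteq> {}" using B by (simp add: box_ne_empty a_def b_def)
  \<comment> \<open>A piece tagged in \<open>C\<close> is confined to \<open>T\<close> and to a ball
    of diameter \<delta>. Tags lie in \<open>C\<close>, hence in \<open>T\<close>, so the value off
    \<open>T\<close> is arbitrary.\<close>
  define g where "g x = (if x \<in> T then T \<inter> ball x (\<delta>/2) else ball x 1)" for x
  have "gauge g" using T(1) \<delta> by (auto simp: gauge_def g_def)
  then obtain \<D> where \<D>: "countable \<D>" "\<Union>\<D> \<subseteq> cbox a b"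
    "\<And>K. K \<in> \<D> \<Longrightarrow> interior K \<noteq> {} \<and> (\<exists>c d. K = cbox c d)"
    "pairwise (\<lambda>A B. interior A \<inter> interior B = {}) \<D>"
    "\<And>K. K \<in> \<D> \<Longrightarrow> \<exists>x \<in> C \<inter> K. K \<subseteq> g x"
    "\<And>u v. cbox u v \<in> \<D> \<Longrightarrow> \<exists>n. \<forall>i \<in> Basis. v \<bullet> i - u \<bullet> i = (b \<bullet> i - a \<bullet> i) / 2^n"
    "C \<subseteq> \<Union>\<D>"
    by (rule covering_lemma[OF Cab box]) blast
  have cube: "K \<subseteq> T" "K \<subseteq> ball x (\<delta>/2)" if "K \<in> \<D>" "x \<in> C \<inter> K" "K \<subseteq> g x" for K x
    using that T(2) by (auto simp: g_def split: if_splits)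
  \<comment> \<open>The family may be finite; its enumeration is padded with empty sets, whose
    diameter 0 adds nothing to the sum.\<close>
  define E where "E n = (if n \<in> to_nat_on \<D> ` \<D> then from_nat_into \<D> n else {})" for n
  have E: "E n = {} \<or> E n \<in> \<D>" for n
    unfolding E_def using \<D>(1) by (auto simp: from_nat_into_to_nat_on)
  have CE: "C \<subseteq> (\<Union>n. E n)"
  proof
    fix x assume "x \<in> C"
    then obtain K where K: "K \<in> \<D>" "x \<in> K" using \<D>(7) by auto
    then have "E (to_nat_on \<D> K) = K" unfolding E_def using \<D>(1) by simp
    then show "x \<in> (\<Union>n. E n)" using K by blast
  qed
  have bE: "bounded (E n)" for n using E[of n] \<D>(3)[of "E n"] by auto
  have dE: "diameter (E n) \<le> \<delta>" for n
  proof (cases "E n = {}")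
    case True then show ?thesis using \<delta> by simp
  next
    case False
    then obtain x where "x \<in> C \<inter> E n" "E n \<subseteq> g x" using \<D>(5)[of "E n"] E[of n] by auto
    then have "diameter (E n) \<le> diameter (ball x (\<delta>/2))"
      using cube(2)[of "E n" x] E[of n] False by (intro diameter_subset) auto
    then show ?thesis using \<delta> by simp
  qed
  have volE: "ennreal (diameter (E n) ^ DIM('a)) = ennreal k * emeasure lborel (interior (E n))" for n
  proof (cases "E n = {}")
    case True then show ?thesis by simp
  next
    case False
    then have En: "E n \<in> \<D>" using E by auto
    then obtain u v where uv: "E n = cbox u v" using \<D>(3) by blast
    then obtain N where N: "\<And>i. i \<in> Basis \<Longrightarrow> v \<bullet> i - u \<bullet> i = (b \<bullet> i - a \<bullet> i) / 2^N"
      using \<D>(6)[of u v] En by auto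
    define s where "s = 2 * B / 2 ^ N"
    have s: "s \<ge> 0" "\<And>i. i \<in> Basis \<Longrightarrow> v \<bullet> i - u \<bullet> i = s"
      using B N by (auto simp: s_def a_def b_def)
    have vu: "v - u = s *\<^sub>R One" by (rule euclidean_eqI) (simp add: inner_diff_left s)
    have le: "\<forall>i\<in>Basis. u \<bullet> i \<le> v \<bullet> i" using s by (metis diff_ge_0_iff_ge)
    have "diameter (E n) = s * norm (One::'a)"
      unfolding uv using diameter_cbox[OF le] s(1) by (simp add: dist_norm norm_minus_commute[of u] vu)
    then have "diameter (E n) ^ DIM('a) = k * s ^ DIM('a)" by (simp add: k_def power_mult_distrib)
    moreover have "emeasure lborel (interior (E n)) = ennreal (s ^ DIM('a))"
      unfolding uv interior_cbox using le s by (simp add: emeasure_lborel_box_eq inner_diff_left)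
    ultimately show ?thesis using k s by (simp add: ennreal_mult')
  qed
  have dis: "disjoint_family (\<lambda>n. interior (E n))"
    unfolding disjoint_family_on_def
  proof (intro ballI impI)
    fix m n :: nat assume mn: "m \<noteq> n"
    show "interior (E m) \<inter> interior (E n) = {}"
    proof (cases "E m = {} \<or> E n = {}")
      case False
      then have r: "m \<in> to_nat_on \<D> ` \<D>" "n \<in> to_nat_on \<D> ` \<D>" by (auto simp: E_def)
      then have "E m \<noteq> E n" using mn \<D>(1) by (auto simp: E_def)
      then show ?thesis using \<D>(4) E[of m] E[of n] False by (auto simp: pairwise_def)
    qed auto
  qed
  have "(\<Sum>n. ennreal (diameter (E n) ^ DIM('a))) = ennreal k * (\<Sum>n. emeasure lborel (interior (E n)))"
    by (simp add: volE)
  also have "(\<Sum>n. emeasure lborel (interior (E n))) = emeasure lborel (\<Union>n. interior (E n))"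
    using dis by (intro suminf_emeasure) auto
  also have "\<dots> \<le> emeasure lborel T"
  proof (rule emeasure_mono)
    show "(\<Union>n. interior (E n)) \<subseteq> T"
    proof
      fix y assume "y \<in> (\<Union>n. interior (E n))"
      then obtain n where y: "y \<in> E n" using interior_subset by blast
      then have En: "E n \<in> \<D>" using E[of n] by auto
      then obtain x where "x \<in> C \<inter> E n" "E n \<subseteq> g x" using \<D>(5) by blast
      then show "y \<in> T" using cube(1)[OF En] y by blast
    qed
  qed (use T(1) in auto)
  also have "emeasure lborel T \<le> ennreal (\<epsilon> / k)" using eT by simp
  also have "ennreal k * ennreal (\<epsilon> / k) = ennreal \<epsilon>" using k \<epsilon> by (simp add: ennreal_mult'[symmetric])
  finally have "(\<Sum>n. ennreal (diameter (E n) ^ DIM('a))) \<le> ennreal \<epsilon>" by (simp add: mult_left_mono)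
  then show ?thesis using that[of E] CE bE dE by blast
qed

lemma diameter_affine_image_le:
  fixes S :: "'a::real_normed_vector set"
  assumes "bounded S" "\<bar>c\<bar> \<le> 1"
  shows "diameter ((\<lambda>x. a + c *\<^sub>R x) ` S) \<le> diameter S"
proof (rule diameter_le)
  show "(\<lambda>x. a + c *\<^sub>R x) ` S \<noteq> {} \<or> 0 \<le> diameter S" using diameter_ge_0[OF assms(1)] by simp
  fix x y assume "x \<in> (\<lambda>x. a + c *\<^sub>R x) ` S" "y \<in> (\<lambda>x. a + c *\<^sub>R x) ` S"
  then obtain x' y' where xy: "x' \<in> S" "y' \<in> S" "x = a + c *\<^sub>R x'" "y = a + c *\<^sub>R y'" by auto
  have "norm (x - y) = \<bar>c\<bar> * dist x' y'" using xy by (simp add: dist_norm scaleR_diff_right[symmetric])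
  also have "\<dots> \<le> 1 * dist x' y'" using assms(2) by (intro mult_right_mono) auto
  also have "\<dots> \<le> diameter S" using diameter_bounded_bound[OF assms(1) xy(1,2)] by simp
  finally show "norm (x - y) \<le> diameter S" .
qed

text \<open>A cover of the cone by sets \<open>E n\<close> induces, for every \<open>t \<in> {1..2}\<close>, the cover of \<open>A\<close> by those
  \<open>c + E n / t\<close> for which \<open>E n\<close> meets the level set \<open>\<phi> = t\<close>. As \<open>\<phi>\<close> is Lipschitz, \<open>E n\<close> meets only
  level sets in an interval of length \<open>O (diameter (E n))\<close>, so that averaging over \<open>t\<close> gains one
  power of the diameter (Eilenberg's inequality).\<close>

lemma hausdorff_measure_null_if_cone_negligible:
  fixes A :: "'a::euclidean_space set" and \<phi> :: "'a \<Rightarrow> real"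
  assumes \<phi>: "M-lipschitz_on UNIV \<phi>" and level: "\<And>a t. a \<in> A \<Longrightarrow> t \<in> {1..2} \<Longrightarrow> \<phi> (t *\<^sub>R (a - c)) = t"
    and neg: "negligible {t *\<^sub>R (a - c) | t a. t \<in> {1..2::real} \<and> a \<in> A}" and bdd: "bounded A"
  shows "hausdorff_measure (DIM('a) - 1) A = 0"
proof -
  define C where "C = {t *\<^sub>R (a - c) | t a. t \<in> {1..2::real} \<and> a \<in> A}"
  define m where "m = DIM('a) - 1"
  have m: "DIM('a) = Suc m" using DIM_positive[where 'a='a] by (simp add: m_def)
  have M: "M \<ge> 0" using \<phi> lipschitz_on_nonneg by blast
  have bC: "bounded C"
  proof -
    have "bounded ((\<lambda>a. a - c) ` A)" using bdd by (rule bounded_translation_minus)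
    then obtain R where "\<And>a. a \<in> A \<Longrightarrow> norm (a - c) \<le> R" by (auto simp: bounded_iff)
    then have "norm x \<le> 2 * R" if "x \<in> C" for x using that unfolding C_def
      by (auto intro!: mult_mono intro: order_trans[OF norm_ge_zero])
    then show ?thesis by (auto simp: bounded_iff)
  qed
  define \<beta> where "\<beta> = unit_ball_vol (real m)"
  have \<beta>: "\<beta> \<ge> 0" by (simp add: \<beta>_def)
  have pre: "hausdorff_pre m \<delta> A \<le> ennreal (2 * M * \<beta> * \<epsilon>)" if \<delta>: "\<delta> > 0" and \<epsilon>: "\<epsilon> > 0" for \<delta> \<epsilon>
  proof -
    obtain E where E: "C \<subseteq> (\<Union>n. E n)" "\<And>n. bounded (E n)" "\<And>n. diameter (E n) \<le> \<delta>"
      "(\<Sum>n. ennreal (diameter (E n) ^ DIM('a))) \<le> ennreal \<epsilon>"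
      using negligible_cover_small_cubes[OF neg[folded C_def] bC \<epsilon> \<delta>] by metis
    define D where "D n = diameter (E n)" for n
    have D: "D n \<ge> 0" for n unfolding D_def using E(2) by (rule diameter_ge_0)
    \<comment> \<open>A reference point of \<open>E n\<close>. If \<open>E n\<close> is empty, its
      value is arbitrary but harmless, as \<open>D n\<close> is 0.\<close>
    define q where "q n = (SOME x. x \<in> E n)" for n
    define J where "J n = {\<phi> (q n) - M * D n .. \<phi> (q n) + M * D n}" for n
    have J: "\<phi> x \<in> J n" if "x \<in> E n" for x n
    proof -
      have "q n \<in> E n" unfolding q_def using that by (rule someI)
      then have "dist x (q n) \<le> D n" unfolding D_def using that by (intro diameter_bounded_bound E)
      then have "M * dist x (q n) \<le> M * D n" using M by (rule mult_left_mono)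
      then show ?thesis using lipschitz_onD[OF \<phi>, of x "q n"] by (auto simp: J_def dist_real_def)
    qed
    have cover: "hausdorff_pre m \<delta> A \<le> (\<Sum>n. ennreal (\<beta> * D n ^ m) * indicator (J n) t)" if t: "t \<in> {1..2}" for t
    proof -
      \<comment> \<open>Scaling by 1/t \<le> 1 does not enlarge diameters. A piece whose interval
        \<open>J n\<close> misses \<open>t\<close> is replaced by the empty set, which costs
        nothing.\<close>
      define E' where "E' n = (if t \<in> J n then (\<lambda>x. c + (1/t) *\<^sub>R x) ` E n else {})" for n
      have t1: "\<bar>1/t\<bar> \<le> 1" using t by auto
      have dE': "diameter (E' n) \<le> D n" for n
        using diameter_affine_image_le[OF E(2) t1] D[of n] by (simp add: E'_def D_def)
      have bE': "bounded (E' n)" for n 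
        using bounded_translation[OF bounded_scaling[OF E(2)], of c "1/t"]
        by (simp add: E'_def image_image)
      have "A \<subseteq> (\<Union>n. E' n)"
      proof
        fix x assume x: "x \<in> A"
        then have "t *\<^sub>R (x - c) \<in> C" using t by (auto simp: C_def)
        then obtain n where n: "t *\<^sub>R (x - c) \<in> E n" using E(1) by auto
        then have "t \<in> J n" using J[OF n] level[OF x t] by simp
        moreover have "x = c + (1/t) *\<^sub>R (t *\<^sub>R (x - c))" using t by simp
        then have "x \<in> (\<lambda>x. c + (1/t) *\<^sub>R x) ` E n" using n by (rule image_eqI)
        ultimately have "x \<in> E' n" by (simp add: E'_def)
        then show "x \<in> (\<Union>n. E' n)" by blast
      qed
      then have "E' \<in> {E. A \<subseteq> (\<Union>n. E n) \<and> (\<forall>n. bounded (E n) \<and> diameter (E n) \<le> \<delta>)}"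
        using bE' order_trans[OF dE'] E(3) by (auto simp: D_def)
      then have "hausdorff_pre m \<delta> A
          \<le> (\<Sum>n. if E' n = {} then 0 else ennreal (unit_ball_vol (real m) * (diameter (E' n) / 2) ^ m))"
        unfolding hausdorff_pre_def by (rule INF_lower)
      also have "\<dots> \<le> (\<Sum>n. ennreal (\<beta> * D n ^ m) * indicator (J n) t)"
      proof (rule suminf_le)
        fix n
        have "\<beta> * (diameter (E' n) / 2) ^ m \<le> \<beta> * D n ^ m"
          using dE'[of n] \<beta> diameter_ge_0[OF bE', of n] by (intro mult_left_mono power_mono) auto
        then show "(if E' n = {} then 0 else ennreal (unit_ball_vol (real m) * (diameter (E' n) / 2) ^ m))
             \<le> ennreal (\<beta> * D n ^ m) * indicator (J n) t"
          by (auto simp: E'_def \<beta>_def ennreal_leI)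
      qed auto
      finally show ?thesis .
    qed
    \<comment> \<open>A constant is its own average over an interval of length 1; this is where the
      bounds for the single t are averaged.\<close>
    have "hausdorff_pre m \<delta> A = (\<integral>\<^sup>+t. hausdorff_pre m \<delta> A * indicator {1..2::real} t \<partial>lborel)"
      by (simp add: nn_integral_cmult_indicator)
    also have "\<dots> \<le> (\<integral>\<^sup>+t. (\<Sum>n. ennreal (\<beta> * D n ^ m) * indicator (J n) t) \<partial>lborel)"
      using cover by (intro nn_integral_mono) (auto split: split_indicator)
    also have "\<dots> = (\<Sum>n. (\<integral>\<^sup>+t. ennreal (\<beta> * D n ^ m) * indicator (J n) t \<partial>lborel))"
      by (rule nn_integral_suminf) (auto simp: J_def)
    also have "\<dots> = (\<Sum>n. ennreal (2 * M * \<beta>) * ennreal (D n ^ DIM('a)))"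
    proof (rule suminf_cong)
      fix n
      have "(\<integral>\<^sup>+t. ennreal (\<beta> * D n ^ m) * indicator (J n) t \<partial>lborel) = ennreal (\<beta> * D n ^ m) * emeasure lborel (J n)"
        by (rule nn_integral_cmult_indicator) (simp add: J_def)
      \<comment> \<open>The length of \<open>J n\<close> supplies the factor that raises the power
        \<open>m\<close> of the diameter to \<open>DIM('a)\<close>.\<close>
      also have "emeasure lborel (J n) = ennreal (2 * M * D n)"
        using M D[of n] by (simp add: J_def)
      also have "ennreal (\<beta> * D n ^ m) * ennreal (2 * M * D n) = ennreal (2 * M * \<beta> * D n ^ DIM('a))"
        using M D[of n] \<beta> by (simp add: ennreal_mult'[symmetric] m mult_ac)
      also have "\<dots> = ennreal (2 * M * \<beta>) * ennreal (D n ^ DIM('a))"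
        using M \<beta> by (intro ennreal_mult') auto
      finally show "(\<integral>\<^sup>+t. ennreal (\<beta> * D n ^ m) * indicator (J n) t \<partial>lborel)
          = ennreal (2 * M * \<beta>) * ennreal (D n ^ DIM('a))" .
    qed
    also have "\<dots> = ennreal (2 * M * \<beta>) * (\<Sum>n. ennreal (D n ^ DIM('a)))" by (rule ennreal_suminf_cmult)
    also have "\<dots> \<le> ennreal (2 * M * \<beta>) * ennreal \<epsilon>"
      using E(4) by (intro mult_left_mono) (auto simp: D_def)
    also have "\<dots> = ennreal (2 * M * \<beta> * \<epsilon>)" using M \<beta> by (intro ennreal_mult'[symmetric]) auto
    finally show ?thesis .
  qed
  have "hausdorff_pre m \<delta> A = 0" if \<delta>: "\<delta> > 0" for \<delta>
  proof -
    have le: "hausdorff_pre m \<delta> A \<le> ennreal e" if e: "e > 0" for e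
    proof -
      define c where "c = 2 * M * \<beta>"
      have c: "c \<ge> 0" using M \<beta> by (simp add: c_def)
      have "hausdorff_pre m \<delta> A \<le> ennreal (c * (e / (c + 1)))"
        unfolding c_def using pre[OF \<delta>, of "e / (c + 1)"] c e by (simp add: c_def)
      also have "\<dots> \<le> ennreal e" using c e by (intro ennreal_leI) (simp add: field_simps)
      finally show ?thesis .
    qed
    have "hausdorff_pre m \<delta> A \<le> 0"
    proof (rule ennreal_le_epsilon)
      show "hausdorff_pre m \<delta> A \<le> 0 + ennreal e" if "e > 0" for e using le[OF that] by simp
    qed
    then show ?thesis by simp
  qed
  then show ?thesis unfolding hausdorff_measure_def m_def[symmetric] by simp
qed

section \<open>Minkowski functionals and tangent cones\<close>

definition minkowski :: "'a::real_vector set \<Rightarrow> 'a \<Rightarrow> real" where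
  "minkowski K w = Inf {t. t > 0 \<and> w /\<^sub>R t \<in> K}"

context
  fixes K :: "'a::euclidean_space set" and r :: real
  assumes K: "convex K" "closed K" and r: "r > 0" "cball 0 r \<subseteq> K"
begin

lemma
  shows minkowski_nonempty: "{t. t > 0 \<and> w /\<^sub>R t \<in> K} \<noteq> {}"
    and minkowski_bdd: "bdd_below {t. t > 0 \<and> w /\<^sub>R t \<in> K}"
    and minkowski_le_norm: "minkowski K w \<le> norm w / r"
    and minkowski_nonneg: "0 \<le> minkowski K w"
proof -
  have mem: "norm w / r + e \<in> {t. t > 0 \<and> w /\<^sub>R t \<in> K}" if e: "e > 0" for e
  proof -
    define t where "t = norm w / r + e"
    have t: "t > 0" using r e by (simp add: t_def add_nonneg_pos)
    have "norm w \<le> r * t" using r e by (simp add: t_def field_simps)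
    then have "norm (w /\<^sub>R t) \<le> r" using t by (simp add: field_simps)
    then have "w /\<^sub>R t \<in> K" using r(2) by (auto simp: subset_iff)
    then show ?thesis using t unfolding t_def by blast
  qed
  show ne: "{t. t > 0 \<and> w /\<^sub>R t \<in> K} \<noteq> {}" using mem[of 1] by auto
  show bdd: "bdd_below {t. t > 0 \<and> w /\<^sub>R t \<in> K}" by (rule bdd_belowI[of _ 0]) auto
  show "minkowski K w \<le> norm w / r"
  proof (rule field_le_epsilon)
    show "minkowski K w \<le> norm w / r + e" if "e > 0" for e
      unfolding minkowski_def by (rule cInf_lower[OF mem[OF that] bdd])
  qed
  show "0 \<le> minkowski K w"
    unfolding minkowski_def using ne by (intro cInf_greatest) auto
qed

text \<open>\<open>K\<close> is star-shaped about 0, so every s > t is admissible in the infimum;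
  closedness then admits the limit s = t as well.\<close>

lemma minkowski_le_iff:
  assumes t: "t > 0"
  shows "minkowski K w \<le> t \<longleftrightarrow> w /\<^sub>R t \<in> K"
proof
  assume "w /\<^sub>R t \<in> K"
  then show "minkowski K w \<le> t" unfolding minkowski_def using t minkowski_bdd by (intro cInf_lower) auto
next
  assume le: "minkowski K w \<le> t"
  have K0: "0 \<in> K" using r by auto
  have mem: "w /\<^sub>R s \<in> K" if "s > t" for s
  proof -
    have "minkowski K w < s" using le that by simp
    then obtain u where u: "u > 0" "w /\<^sub>R u \<in> K" "u < s"
      unfolding minkowski_def using cInf_lessD[OF minkowski_nonempty, of w s] by auto
    have "(u/s) *\<^sub>R (w /\<^sub>R u) \<in> K"
      using convexD_alt[OF K(1) K0 u(2), of "u/s"] u by simp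
    then show ?thesis using u by (simp add: inverse_eq_divide)
  qed
  have "(\<lambda>n. w /\<^sub>R (t + 1 / Suc n)) \<longlonglongrightarrow> w /\<^sub>R (t + 0)"
    using t by (intro tendsto_intros LIMSEQ_Suc[OF lim_1_over_n]) auto
  then have "w /\<^sub>R (t + 0) \<in> K"
    by (rule Lim_in_closed_set[OF K(2), rotated -1]) (intro always_eventually allI mem, simp_all)
  then show "w /\<^sub>R t \<in> K" by simp
qed

lemma minkowski_le_1_iff: "minkowski K w \<le> 1 \<longleftrightarrow> w \<in> K"
  using minkowski_le_iff[of 1 w] by simp

lemma minkowski_scaleR:
  assumes c: "c > 0"
  shows "minkowski K (c *\<^sub>R w) = c * minkowski K w"
proof -
  have le: "minkowski K (c *\<^sub>R w) \<le> c * minkowski K w" if c: "c > 0" for c w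
  proof (rule field_le_epsilon)
    fix e :: real assume e: "e > 0"
    define t where "t = minkowski K w + e / c"
    have t: "t > 0" using minkowski_nonneg[of w] e c by (simp add: t_def add_nonneg_pos)
    have "w /\<^sub>R t \<in> K" using minkowski_le_iff[OF t, of w] e c by (simp add: t_def)
    moreover have "(c *\<^sub>R w) /\<^sub>R (c * t) = w /\<^sub>R t" using c t by (simp add: inverse_eq_divide)
    ultimately have "(c *\<^sub>R w) /\<^sub>R (c * t) \<in> K" by (simp only:)
    then have "minkowski K (c *\<^sub>R w) \<le> c * t" using c t by (subst minkowski_le_iff) auto
    then show "minkowski K (c *\<^sub>R w) \<le> c * minkowski K w + e" using c by (simp add: t_def algebra_simps)
  qed
  \<comment> \<open>The reverse inequality is the same one for the factor 1/c.\<close>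
  have "minkowski K ((1/c) *\<^sub>R (c *\<^sub>R w)) \<le> (1/c) * minkowski K (c *\<^sub>R w)" using c by (intro le) simp
  then have "c * minkowski K w \<le> minkowski K (c *\<^sub>R w)" using c by (simp add: field_simps)
  then show ?thesis using le[OF c, of w] by simp
qed

lemma minkowski_add: "minkowski K (v + w) \<le> minkowski K v + minkowski K w"
proof (rule field_le_epsilon)
  fix e :: real assume e: "e > 0"
  define s t where "s = minkowski K v + e/2" and "t = minkowski K w + e/2"
  have st: "s > 0" "t > 0" using minkowski_nonneg[of v] minkowski_nonneg[of w] e by (auto simp: s_def t_def add_nonneg_pos)
  have "v /\<^sub>R s \<in> K" "w /\<^sub>R t \<in> K"
    using minkowski_le_iff[OF st(1), of v] minkowski_le_iff[OF st(2), of w] e by (auto simp: s_def t_def)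
  then have "(s/(s+t)) *\<^sub>R (v /\<^sub>R s) + (t/(s+t)) *\<^sub>R (w /\<^sub>R t) \<in> K"
    using st by (intro convexD[OF K(1)]) (auto simp: add_divide_distrib[symmetric])
  also have "(s/(s+t)) *\<^sub>R (v /\<^sub>R s) + (t/(s+t)) *\<^sub>R (w /\<^sub>R t) = (v + w) /\<^sub>R (s + t)"
    using st by (simp add: inverse_eq_divide scaleR_add_right)
  finally have "minkowski K (v + w) \<le> s + t" using st by (subst minkowski_le_iff) auto
  then show "minkowski K (v + w) \<le> minkowski K v + minkowski K w + e" by (simp add: s_def t_def)
qed

text \<open>Subadditivity bounds a difference of values by the value at the difference, which is at
  most its norm divided by \<open>r\<close>.\<close>

lemma minkowski_lipschitz: "(1/r)-lipschitz_on UNIV (minkowski K)"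
proof (rule lipschitz_onI)
  fix v w :: 'a
  have "minkowski K a \<le> minkowski K b + norm (a - b) / r" for a b
    using minkowski_add[of b "a - b"] minkowski_le_norm[of "a - b"] by simp
  from this[of v w] this[of w v]
  show "dist (minkowski K v) (minkowski K w) \<le> 1 / r * dist v w"
    by (auto simp: dist_real_def dist_norm norm_minus_commute abs_le_iff)
qed (use r in auto)

text \<open>By continuity the points with value below 1 form an open subset of \<open>K\<close>, so
  they are interior and cannot be frontier points.\<close>

lemma minkowski_frontier:
  assumes "w \<in> frontier K"
  shows "minkowski K w = 1"
proof (rule antisym)
  have "w \<in> K" "w \<notin> interior K" using assms K(2) by (auto simp: frontier_def)
  then show "minkowski K w \<le> 1" by (simp add: minkowski_le_1_iff)
  have "continuous_on UNIV (minkowski K)"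
    using minkowski_lipschitz lipschitz_on_continuous_on by blast
  then have "open {v. minkowski K v < 1}" by (intro open_Collect_less) auto
  moreover have "{v. minkowski K v < 1} \<subseteq> K" by (auto simp: minkowski_le_1_iff[symmetric])
  ultimately have "{v. minkowski K v < 1} \<subseteq> interior K" by (rule interior_maximal[rotated])
  then have "\<not> minkowski K w < 1" using \<open>w \<notin> interior K\<close> by blast
  then show "1 \<le> minkowski K w" by simp
qed

end

text \<open>Here \<open>\<rho> B \<subseteq> (\<rho>/r) K\<close> turns the additive perturbation into a multiplicative one.\<close>

lemma minkowski_le_of_near:
  fixes K K' :: "'a::euclidean_space set"
  assumes K: "convex K" "closed K" and r: "r > 0" "cball 0 r \<subseteq> K"
    and K': "convex K'" "closed K'" and r': "r' > 0" "cball 0 r' \<subseteq> K'" and \<rho>: "\<rho> \<ge> 0"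
    and near: "\<And>y. y \<in> K' \<Longrightarrow> \<exists>z\<in>K. norm (y - z) \<le> \<rho>"
  shows "minkowski K w \<le> (1 + \<rho> / r) * minkowski K' w"
proof -
  note mink' = minkowski_le_iff[OF K' r'] minkowski_nonneg[OF K' r']
  have "minkowski K w \<le> (1 + \<rho> / r) * t" if t: "t > minkowski K' w" for t
  proof -
    have t0: "t > 0" using t mink'(2)[of w] by simp
    then have "w /\<^sub>R t \<in> K'" using mink'(1)[of t w] t by simp
    then obtain z where z: "z \<in> K" "norm (w /\<^sub>R t - z) \<le> \<rho>" using near by blast
    have "minkowski K (w /\<^sub>R t) \<le> minkowski K z + minkowski K (w /\<^sub>R t - z)"
      using minkowski_add[OF K r, of z "w /\<^sub>R t - z"] by simp
    also have "minkowski K z \<le> 1" using z by (simp add: minkowski_le_1_iff[OF K r])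
    also have "minkowski K (w /\<^sub>R t - z) \<le> norm (w /\<^sub>R t - z) / r" by (rule minkowski_le_norm[OF K r])
    also have "\<dots> \<le> \<rho> / r" using z r by (simp add: divide_right_mono)
    finally have "minkowski K (w /\<^sub>R t) \<le> 1 + \<rho> / r" by simp
    moreover have "minkowski K w = t * minkowski K (w /\<^sub>R t)"
      using minkowski_scaleR[OF K r t0, of "w /\<^sub>R t"] t0 by simp
    ultimately show ?thesis using t0 by (simp add: mult.commute)
  qed
  moreover have "1 + \<rho> / r > 0" using \<rho> r by (simp add: add_pos_nonneg)
  \<comment> \<open>The bound survives the limit as \<open>t\<close> decreases to
    \<open>minkowski K' w\<close>.\<close>
  ultimately show ?thesis
    by (metis dense_le_bounded dual_order.refl lt_ex mult.commute not_le pos_divide_le_eq dense_ge)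
qed

text \<open>Separating a point outside \<open>K\<close> and moving it by \<open>\<rho>\<close> along the normal contradicts the inclusion.\<close>

lemma cball_subset_of_near:
  fixes K :: "'a::euclidean_space set"
  assumes K: "convex K" "closed K" "K \<noteq> {}"
    and near: "\<And>y. y \<in> cball c R \<Longrightarrow> \<exists>z\<in>K. norm (y - z) \<le> \<rho>" and \<rho>: "0 \<le> \<rho>"
  shows "cball c (R - \<rho>) \<subseteq> K"
proof (rule subsetI, rule ccontr)
  fix z assume z: "z \<in> cball c (R - \<rho>)" "z \<notin> K"
  obtain a b where ab: "a \<bullet> z < b" "\<And>x. x \<in> K \<Longrightarrow> a \<bullet> x > b"
    using separating_hyperplane_closed_point[OF K(1,2) z(2)] by blast
  then have a: "a \<noteq> 0" using K(3) by force
  define u where "u = a /\<^sub>R norm a"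
  have u: "norm u = 1" using a by (simp add: u_def)
  have "dist c (z - \<rho> *\<^sub>R u) \<le> dist c z + \<rho>"
    using dist_triangle[of c "z - \<rho> *\<^sub>R u" z] u \<rho> by (simp add: dist_norm)
  then obtain y where y: "y \<in> K" "norm (z - \<rho> *\<^sub>R u - y) \<le> \<rho>"
    using near[of "z - \<rho> *\<^sub>R u"] z by auto
  have "a \<bullet> (z - y) < 0" using ab(1) ab(2)[OF y(1)] by (simp add: inner_diff_right)
  then have "u \<bullet> (z - y) < 0" using a by (simp add: u_def mult_less_0_iff)
  moreover have "u \<bullet> u = 1" using u by (simp add: norm_eq_1)
  then have "u \<bullet> (z - \<rho> *\<^sub>R u - y) = u \<bullet> (z - y) - \<rho>" by (simp add: inner_diff_right)
  moreover have "\<bar>u \<bullet> (z - \<rho> *\<^sub>R u - y)\<bar> \<le> \<rho>"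
    using Cauchy_Schwarz_ineq2[of u "z - \<rho> *\<^sub>R u - y"] u y by simp
  ultimately show False by simp
qed

section \<open>First-order description of tangent cones to sublevel sets\<close>

lemma tangent_cone_sublevel:
  fixes G :: "'a::real_normed_vector \<Rightarrow> real"
  assumes G: "(G has_derivative D) (at z)" and e: "D e > 0" and \<delta>: "\<delta> > 0"
    and S: "\<And>u. dist z u < \<delta> \<Longrightarrow> u \<in> S \<longleftrightarrow> G u \<le> G z"
  shows "tangent_cone S z = {u. D u \<le> 0}"
proof -
  interpret D: bounded_linear D using G by (rule has_derivative_bounded_linear)
  have approx: "\<exists>d>0. \<forall>v. norm v < d \<longrightarrow> \<bar>G (z + v) - G z - D v\<bar> \<le> c * norm v" if c: "c > 0" for c
  proof -
    obtain d where d: "d > 0" "\<And>y. norm (y - z) < d \<Longrightarrow> norm (G y - G z - D (y - z)) \<le> c * norm (y - z)"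
      using G[unfolded has_derivative_at_alt, THEN conjunct2, rule_format, OF c] by blast
    have "\<bar>G (z + v) - G z - D v\<bar> \<le> c * norm v" if "norm v < d" for v
      using d(2)[of "z + v"] that by simp
    then show ?thesis using d(1) by blast
  qed
  show ?thesis
  proof (intro set_eqI iffI CollectI)
    fix u assume "u \<in> tangent_cone S z"
    then obtain h v where hv: "\<And>n. h n > 0" "h \<longlonglongrightarrow> 0" "v \<longlonglongrightarrow> u" "\<And>n. z + h n *\<^sub>R v n \<in> S"
      unfolding tangent_cone_def by blast
    \<comment> \<open>The expansion of \<open>G\<close> along the tangent sequence, divided by
      \<open>h n\<close>, gives this bound for \<open>v n\<close> eventually; then n tends to
      infinity.\<close>
    have "D u \<le> c * norm u" if c: "c > 0" for c
    proof -
      obtain d where d: "d > 0" "\<And>v. norm v < d \<Longrightarrow> \<bar>G (z + v) - G z - D v\<bar> \<le> c * norm v"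
        using approx[OF c] by blast
      have "(\<lambda>n. norm (h n *\<^sub>R v n)) \<longlonglongrightarrow> norm (0 *\<^sub>R u)" by (intro tendsto_intros hv)
      then have "eventually (\<lambda>n. norm (h n *\<^sub>R v n) < min d \<delta>) sequentially"
        using d(1) \<delta> by (intro order_tendstoD) auto
      then have "eventually (\<lambda>n. D (v n) \<le> c * norm (v n)) sequentially"
      proof (rule eventually_mono)
        fix n assume n: "norm (h n *\<^sub>R v n) < min d \<delta>"
        then have "G (z + h n *\<^sub>R v n) \<le> G z" using S[of "z + h n *\<^sub>R v n"] hv(4)[of n] by (simp add: dist_norm)
        moreover have "\<bar>G (z + h n *\<^sub>R v n) - G z - D (h n *\<^sub>R v n)\<bar> \<le> c * norm (h n *\<^sub>R v n)" using n by (intro d(2)) simp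
        moreover have "c * norm (h n *\<^sub>R v n) = h n * (c * norm (v n))" using hv(1)[of n] by simp
        moreover have "D (h n *\<^sub>R v n) = h n * D (v n)" by (simp add: D.scaleR)
        ultimately have "h n * D (v n) \<le> h n * (c * norm (v n))" by linarith
        then show "D (v n) \<le> c * norm (v n)" using hv(1)[of n] by simp
      qed
      moreover have "(\<lambda>n. D (v n)) \<longlonglongrightarrow> D u" by (intro D.tendsto hv)
      moreover have "(\<lambda>n. c * norm (v n)) \<longlonglongrightarrow> c * norm u" by (intro tendsto_intros hv)
      ultimately show ?thesis by (intro tendsto_le[OF sequentially_bot]) auto
    qed
    note le = this
    show "D u \<le> 0"
    proof (rule field_le_epsilon)
      fix c :: real assume c: "c > 0"
      have nu: "norm u + 1 > 0" by (simp add: add_nonneg_pos)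
      have "D u \<le> c / (norm u + 1) * norm u" using c nu by (intro le) simp
      also have "\<dots> \<le> c / (norm u + 1) * (norm u + 1)" using c nu by (intro mult_left_mono) auto
      also have "\<dots> = c" using nu by simp
      finally show "D u \<le> 0 + c" by simp
    qed
  next
    fix u assume "u \<in> {u. D u \<le> 0}"
    then have u: "D u \<le> 0" by simp
    \<comment> \<open>A direction with D u = 0 may leave the sublevel set, so it is pushed slightly
      along -e to obtain a strict decrease.\<close>
    define v where "v n = u - (1 / Suc n) *\<^sub>R e" for n
    have Dv: "D (v n) < 0" for n
    proof -
      have "(1 / Suc n) * D e > 0" using e by simp
      then show ?thesis using u unfolding v_def D.diff D.scaleR by simp
    qed
    have "\<exists>h>0. h < 1 / Suc n \<and> z + h *\<^sub>R v n \<in> S" for n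
    proof -
      define w where "w = v n"
      \<comment> \<open>With this \<open>c\<close> the first-order error is at most the decrease
        \<open>- D w\<close>; the 1 keeps the denominator positive.\<close>
      define c where "c = - D w / (norm w + 1)"
      have w: "D w < 0" using Dv by (simp add: w_def)
      have nw: "norm w + 1 > 0" by (simp add: add_nonneg_pos)
      have c: "c > 0" unfolding c_def using w nw by (intro divide_pos_pos) auto
      have "c * norm w \<le> c * (norm w + 1)" using c by simp
      also have "\<dots> = - D w" using nw by (simp add: c_def)
      finally have cw: "c * norm w \<le> - D w" .
      obtain d where d: "d > 0" "\<And>v. norm v < d \<Longrightarrow> \<bar>G (z + v) - G z - D v\<bar> \<le> c * norm v"
        using approx[OF c] by blast
      have "min d \<delta> / (norm w + 1) > 0" using d(1) \<delta> nw by (intro divide_pos_pos) auto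
      then obtain h where h: "h > 0" "h < 1 / Suc n" "h < min d \<delta> / (norm w + 1)"
        using field_lbound_gt_zero[of "1 / Suc n" "min d \<delta> / (norm w + 1)"] by auto
      have "norm (h *\<^sub>R w) = h * norm w" using h by simp
      also have "\<dots> \<le> h * (norm w + 1)" using h by simp
      also have "\<dots> < min d \<delta>" using h(3) nw by (simp add: pos_less_divide_eq)
      finally have hw: "norm (h *\<^sub>R w) < min d \<delta>" .
      then have "\<bar>G (z + h *\<^sub>R w) - G z - D (h *\<^sub>R w)\<bar> \<le> c * norm (h *\<^sub>R w)" by (intro d(2)) simp
      moreover have "c * norm (h *\<^sub>R w) = h * (c * norm w)" using h by simp
      moreover have "h * (c * norm w) \<le> h * (- D w)" using cw h by (intro mult_left_mono) auto
      moreover have "D (h *\<^sub>R w) = h * D w" by (simp add: D.scaleR)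
      ultimately have "G (z + h *\<^sub>R w) \<le> G z" by linarith
      then have "z + h *\<^sub>R w \<in> S" using S[of "z + h *\<^sub>R w"] hw by (simp add: dist_norm)
      then show ?thesis using h unfolding w_def by blast
    qed
    then obtain h where h: "\<And>n. h n > 0 \<and> h n < 1 / Suc n \<and> z + h n *\<^sub>R v n \<in> S" by metis
    have lim: "(\<lambda>n. 1 / real (Suc n)) \<longlonglongrightarrow> 0" by (rule LIMSEQ_Suc[OF lim_1_over_n])
    have "h \<longlonglongrightarrow> 0"
      by (rule tendsto_sandwich[OF _ _ tendsto_const lim]) (use h in \<open>auto intro!: always_eventually less_imp_le\<close>)
    moreover have "v \<longlonglongrightarrow> u - 0 *\<^sub>R e" unfolding v_def by (intro tendsto_intros lim)
    ultimately show "u \<in> tangent_cone S z"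
      unfolding tangent_cone_def using h by (intro CollectI exI[of _ h] exI[of _ v]) auto
  qed
qed

text \<open>Fubini is applied to a Borel null superset, since \<open>N\<close> itself need not be
  Borel.\<close>

lemma negligible_slices:
  fixes N :: "('a::euclidean_space \<times> 'b::euclidean_space) set"
  assumes "negligible N"
  shows "negligible {x. \<not> negligible {y. (x, y) \<in> N}}"
proof -
  obtain N' where N': "N' \<in> null_sets (lborel :: ('a \<times> 'b) measure)" "N \<subseteq> N'"
    using assms unfolding negligible_iff_null_sets null_sets_completion_iff2 by blast
  have "AE z in lborel. z \<notin> N'" using N'(1) by (rule AE_not_in)
  then have "AE z in (lborel :: 'a measure) \<Otimes>\<^sub>M (lborel :: 'b measure). z \<notin> N'"
    by (simp only: lborel_prod)
  then have "AE x in (lborel :: 'a measure). AE y in (lborel :: 'b measure). (x, y) \<notin> N'"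
    by (rule lborel_pair.AE_pair)
  then have null: "{x. \<not> (AE y in (lborel :: 'b measure). (x, y) \<notin> N')} \<in> null_sets lebesgue"
    unfolding null_sets_completion_iff2 eventually_ae_filter by auto
  have nn: "negligible {y. (x, y) \<in> N}" if "AE y in (lborel :: 'b measure). (x, y) \<notin> N'" for x
  proof -
    have "{y. (x, y) \<in> N'} \<in> null_sets lebesgue"
      using that unfolding null_sets_completion_iff2 eventually_ae_filter by auto
    then have "negligible {y. (x, y) \<in> N'}" by (simp only: negligible_iff_null_sets)
    then show ?thesis by (rule negligible_subset) (use N'(2) in auto)
  qed
  have "{x. \<not> negligible {y. (x, y) \<in> N}} \<subseteq> {x. \<not> (AE y in (lborel :: 'b measure). (x, y) \<notin> N')}"
  proof (intro subsetI CollectI notI)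
    fix x assume "x \<in> {x. \<not> negligible {y. (x, y) \<in> N}}" and "AE y in (lborel :: 'b measure). (x, y) \<notin> N'"
    then show False using nn[of x] by simp
  qed
  then show ?thesis
    by (rule negligible_subset[OF null[folded negligible_iff_null_sets]])
qed

section \<open>Differentiability of the set-valued map\<close>

lemma half_space_sublevel:
  fixes D :: "'a::euclidean_space \<Rightarrow> real"
  assumes "bounded_linear D" "D e \<noteq> 0"
  shows "half_space {u. D u \<le> 0}" "closed {u. D u \<le> 0}" "convex_cone {u. D u \<le> 0}"
proof -
  interpret bounded_linear D by fact
  \<comment> \<open>The vector that represents \<open>D\<close> as an inner product.\<close>
  define a where "a = adjoint D 1"
  have a: "a \<bullet> u = D u" for u
    using adjoint_works[OF linear_axioms, of u 1] by (simp add: a_def inner_commute)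
  then have "a \<noteq> 0" using assms(2) by (metis inner_zero_left)
  then show "half_space {u. D u \<le> 0}"
    unfolding half_space_def by (intro exI[of _ a] exI[of _ 0]) (simp add: a)
  show "closed {u. D u \<le> 0}" unfolding a[symmetric] by (rule closed_halfspace_le)
  show "convex_cone {u. D u \<le> 0}"
    unfolding convex_cone_def conic_def a[symmetric]
    by (auto simp: convex_halfspace_le mult_nonneg_nonpos intro: exI[of _ 0])
qed

text \<open>The Hausdorff Lipschitz property is the case \<open>p = 0\<close> of the isotropic one.\<close>

lemma locally_isotropically_LipschitzD:
  fixes F :: "'a::euclidean_space \<Rightarrow> 'b::euclidean_space set"
  assumes F: "locally_isotropically_Lipschitz F" and ne: "\<And>x. F x \<noteq> {}"
  obtains k U where "k > 0" "open U" "a \<in> U"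
    "\<And>x x' y. x \<in> U \<Longrightarrow> x' \<in> U \<Longrightarrow> y \<in> F x \<Longrightarrow> \<exists>z\<in>F x'. norm (y - z) \<le> k * norm (x - x')"
proof -
  obtain k U where kU: "k > 0" "open U" "a \<in> U"
    and sub: "\<And>p x x'. x \<in> U \<Longrightarrow> x' \<in> U \<Longrightarrow> support_set F x p \<subseteq>
             {y + (k * norm (x - x')) *\<^sub>R b | y b. y \<in> support_set F x' p \<and> b \<in> cball 0 1}"
    using F unfolding locally_isotropically_Lipschitz_def by meson
  have supp0: "support_set F x 0 = F x" for x
    using ne[of x] by (simp add: support_set_def support_fun_def)
  have "\<exists>z\<in>F x'. norm (y - z) \<le> k * norm (x - x')" if xy: "x \<in> U" "x' \<in> U" "y \<in> F x" for x x' y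
  proof -
    obtain z b where zb: "y = z + (k * norm (x - x')) *\<^sub>R b" "z \<in> F x'" "b \<in> cball 0 1"
      using sub[OF xy(1,2), of 0] xy(3) unfolding supp0 by blast
    have "norm (y - z) = k * norm (x - x') * norm b" using zb kU(1) by (simp add: abs_mult)
    also have "\<dots> \<le> k * norm (x - x') * 1" using zb(3) kU(1) by (intro mult_left_mono) auto
    finally show ?thesis using zb(2) by auto
  qed
  then show ?thesis using that[OF kU] by blast
qed

text \<open>Along a convergent sequence in the graph, the distance of the second components to
  \<open>F x\<close> is at most k times that of the first components to x, which tends to 0.\<close>

lemma closed_gph:
  fixes F :: "'a::euclidean_space \<Rightarrow> 'b::euclidean_space set"
  assumes F: "locally_isotropically_Lipschitz F" and ne: "\<And>x. F x \<noteq> {}" and cl: "\<And>x. closed (F x)"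
  shows "closed (gph F)"
  unfolding closed_sequential_limits
proof (intro allI impI, elim conjE)
  fix s :: "nat \<Rightarrow> 'a \<times> 'b" and l
  assume s: "\<forall>n. s n \<in> gph F" and lim: "s \<longlonglongrightarrow> l"
  obtain x y where l: "l = (x, y)" by (cases l)
  have sx: "(\<lambda>n. fst (s n)) \<longlonglongrightarrow> x" and sy: "(\<lambda>n. snd (s n)) \<longlonglongrightarrow> y"
    using tendsto_fst[OF lim] tendsto_snd[OF lim] by (simp_all add: l)
  obtain k U where kU: "k > 0" "open U" "x \<in> U"
    "\<And>x1 x2 y. x1 \<in> U \<Longrightarrow> x2 \<in> U \<Longrightarrow> y \<in> F x1 \<Longrightarrow> \<exists>z\<in>F x2. norm (y - z) \<le> k * norm (x1 - x2)"
    using locally_isotropically_LipschitzD[OF F ne, where a=x] by blast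
  have "eventually (\<lambda>n. fst (s n) \<in> U) sequentially"
    using topological_tendstoD[OF sx kU(2,3)] .
  then have "eventually (\<lambda>n. infdist (snd (s n)) (F x) \<le> k * norm (fst (s n) - x)) sequentially"
  proof (rule eventually_mono)
    fix n assume "fst (s n) \<in> U"
    moreover have "snd (s n) \<in> F (fst (s n))" using s[rule_format, of n] by (simp add: gph_def case_prod_beta)
    ultimately obtain z where "z \<in> F x" "norm (snd (s n) - z) \<le> k * norm (fst (s n) - x)"
      using kU(3,4) by blast
    then show "infdist (snd (s n)) (F x) \<le> k * norm (fst (s n) - x)"
      using infdist_le[of z "F x" "snd (s n)"] by (simp add: dist_norm)
  qed
  moreover have "(\<lambda>n. infdist (snd (s n)) (F x)) \<longlonglongrightarrow> infdist y (F x)" by (intro tendsto_intros sy)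
  moreover have "(\<lambda>n. k * norm (fst (s n) - x)) \<longlonglongrightarrow> k * norm (x - x)" by (intro tendsto_intros sx)
  ultimately have "infdist y (F x) \<le> k * norm (x - x)" by (intro tendsto_le[OF sequentially_bot]) auto
  then have "infdist y (F x) = 0" using infdist_nonneg[of y "F x"] by simp
  then have "y \<in> F x" using in_closed_iff_infdist_zero[OF cl ne] by blast
  then show "l \<in> gph F" by (simp add: l gph_def)
qed

text \<open>\<open>G\<close> is the Minkowski functional of \<open>F x - c\<close>; by homogeneity its derivative at \<open>(x, y - c)\<close>
  in the radial direction \<open>(0, y - c)\<close> equals \<open>G (x, y - c) = 1\<close>.\<close>

lemma half_space_of_differentiable_gauge:
  fixes F :: "'a::euclidean_space \<Rightarrow> 'b::euclidean_space set" and G :: "'a \<times> 'b \<Rightarrow> real"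
  assumes cl: "closed (gph F)" and W: "open W" "x \<in> W"
    and mem: "\<And>x y. x \<in> W \<Longrightarrow> y \<in> F x \<longleftrightarrow> G (x, y - c) \<le> 1"
    and hom: "\<And>x t w. x \<in> W \<Longrightarrow> t > 0 \<Longrightarrow> G (x, t *\<^sub>R w) = t * G (x, w)"
    and one: "G (x, y - c) = 1" and diff: "G differentiable (at (x, y - c))"
  shows "sv_differentiable F x y \<and> half_space (gph (graphical_derivative F x y))"
proof -
  obtain D where D: "(G has_derivative D) (at (x, y - c))"
    using diff by (auto simp: differentiable_def)
  then interpret D: bounded_linear D by (rule has_derivative_bounded_linear)
  define H where "H z = G (z - (0, c))" for z
  have shift: "((\<lambda>z. z - (0, c)) has_derivative (\<lambda>z. z)) (at (x, y))"
    by (auto intro!: derivative_eq_intros)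
  have HD: "(H has_derivative D) (at (x, y))"
    unfolding H_def using has_derivative_compose[OF shift, of G D] D by simp
  have "D (0, y - c) = 1"
  proof -
    have 1: "((\<lambda>s::real. (x, y - c) + s *\<^sub>R (0, y - c)) has_derivative (\<lambda>s. s *\<^sub>R (0, y - c))) (at 0)"
      by (auto intro!: derivative_eq_intros)
    have "((\<lambda>s. G ((x, y - c) + s *\<^sub>R (0, y - c))) has_derivative (\<lambda>s. D (s *\<^sub>R (0, y - c)))) (at 0)"
      using has_derivative_compose[OF 1, of G D] D by simp
    then have "((\<lambda>s. G ((x, y - c) + s *\<^sub>R (0, y - c))) has_derivative (\<lambda>s. s * D (0, y - c))) (at 0)"
      by (simp only: D.scaleR real_scaleR_def)
    then have "((\<lambda>s. 1 + s) has_derivative (\<lambda>s. s * D (0, y - c))) (at (0::real))"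
    proof (rule has_derivative_transform_within[where d=1])
      fix s :: real assume "dist s 0 < 1"
      then have s: "1 + s > 0" by (simp add: dist_real_def)
      have "(x, y - c) + s *\<^sub>R (0, y - c) = (x, (1 + s) *\<^sub>R (y - c))" by (simp add: scaleR_add_left)
      then show "G ((x, y - c) + s *\<^sub>R (0, y - c)) = 1 + s" using hom[OF W(2) s] one by simp
    qed auto
    moreover have "((\<lambda>s. 1 + s) has_derivative (\<lambda>s. s)) (at (0::real))" by (auto intro!: derivative_eq_intros)
    ultimately have "(\<lambda>s. s * D (0, y - c)) = (\<lambda>s. s)" by (rule has_derivative_unique)
    then show ?thesis by (metis mult_1)
  qed
  note De = this
  obtain \<delta> where \<delta>: "\<delta> > 0" "ball x \<delta> \<subseteq> W" using W open_contains_ball by blast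
  have Hxy: "H (x, y) = 1" using one by (simp add: H_def)
  have "tangent_cone (gph F) (x, y) = {u. D u \<le> 0}"
  proof (rule tangent_cone_sublevel[OF HD _ \<delta>(1)])
    show "D (0, y - c) > 0" using De by simp
    fix u :: "'a \<times> 'b" assume u: "dist (x, y) u < \<delta>"
    obtain x' y' where u': "u = (x', y')" by (cases u)
    have "dist x x' < \<delta>" using u dist_fst_le[of "(x, y)" u] by (simp add: u')
    then have "x' \<in> W" using \<delta> by auto
    then show "u \<in> gph F \<longleftrightarrow> H u \<le> H (x, y)" unfolding Hxy using mem by (simp add: u' gph_def H_def)
  qed
  moreover have "gph (graphical_derivative F x y) = tangent_cone (gph F) (x, y)"
    by (auto simp: gph_def graphical_derivative_def)
  moreover have "(x, y) \<in> gph F" using mem[OF W(2), of y] one by (simp add: gph_def)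
  ultimately show ?thesis
    using half_space_sublevel[OF D.bounded_linear_axioms, of "(0, y - c)"] De cl
    by (simp add: sv_differentiable_def convex_process_def)
qed

text \<open>One ball about a common centre \<open>c\<close> inside all nearby \<open>F x\<close>
  makes their gauges comparable. For almost every x the gauge is then differentiable at almost every
  w, and the bad boundary points generate a null cone.\<close>

lemma negligible_bad_locally:
  fixes F :: "'a::euclidean_space \<Rightarrow> 'b::euclidean_space set"
  assumes ne: "\<And>x. F x \<noteq> {}" and cvx: "\<And>x. convex (F x)" and cpt: "\<And>x. compact (F x)"
    and lip: "locally_isotropically_Lipschitz F" and int: "interior (F x0) \<noteq> {}"
  obtains W where "open W" "x0 \<in> W"
    "negligible {x \<in> W. hausdorff_measure (DIM('b) - 1)
             {y \<in> frontier (F x).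
                \<not> (sv_differentiable F x y \<and> half_space (gph (graphical_derivative F x y)))} \<noteq> 0}"
proof -
  obtain k U where kU: "k > 0" "open U" "x0 \<in> U"
    and near: "\<And>x x' y. x \<in> U \<Longrightarrow> x' \<in> U \<Longrightarrow> y \<in> F x \<Longrightarrow> \<exists>z\<in>F x'. norm (y - z) \<le> k * norm (x - x')"
    using locally_isotropically_LipschitzD[OF lip ne, where a=x0] by blast
  obtain c R where R: "R > 0" "cball c R \<subseteq> F x0"
    using int by (metis ex_in_conv mem_interior_cball)
  define r where "r = R / 2"
  have r: "r > 0" using R by (simp add: r_def)
  \<comment> \<open>On this ball \<open>F\<close> moves by at most \<open>r\<close>, so of the inner
    ball of radius R = 2 r in \<open>F x0\<close> a ball of radius \<open>r\<close> remains in every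
    \<open>F x\<close>.\<close>
  define W where "W = U \<inter> ball x0 (r / k)"
  have W: "open W" "x0 \<in> W" "W \<subseteq> U" using kU r by (auto simp: W_def)
  define K where "K x = (\<lambda>y. y - c) ` F x" for x
  have Kc: "convex (K x)" "closed (K x)" for x
    using cvx cpt by (auto simp: K_def convex_translation_subtract_eq compact_translation_subtract compact_imp_closed)
  have KF: "w \<in> K x \<longleftrightarrow> c + w \<in> F x" for w x by (force simp: K_def image_iff)
  have Kr: "cball 0 r \<subseteq> K x" if x: "x \<in> W" for x
  proof -
    define \<rho> where "\<rho> = k * norm (x0 - x)"
    have \<rho>: "0 \<le> \<rho>" "\<rho> \<le> r" using x kU(1) by (auto simp: \<rho>_def W_def dist_norm field_simps)
    have "cball c (R - \<rho>) \<subseteq> F x"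
    proof (rule cball_subset_of_near)
      show "\<exists>z\<in>F x. norm (y - z) \<le> \<rho>" if "y \<in> cball c R" for y
        unfolding \<rho>_def using near[of x0 x y] that x W R by blast
    qed (use cvx cpt ne \<rho> in \<open>auto simp: compact_imp_closed\<close>)
    moreover have "r \<le> R - \<rho>" using \<rho> by (simp add: r_def)
    ultimately show ?thesis by (fastforce simp: KF subset_iff dist_norm)
  qed
  define G where "G = (\<lambda>(x, w). minkowski (K x) w)"
  have nearK: "\<exists>z\<in>K x'. norm (w - z) \<le> k * norm (x - x')" if xw: "x \<in> W" "x' \<in> W" "w \<in> K x" for x x' w
  proof -
    have "x \<in> U" "x' \<in> U" using xw W(3) by auto
    then obtain z where "z \<in> F x'" "norm (c + w - z) \<le> k * norm (x - x')"
      using near[of x x' "c + w"] xw(3) by (auto simp: KF)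
    then show ?thesis by (intro bexI[of _ "z - c"]) (auto simp: KF algebra_simps)
  qed
  \<comment> \<open>The Lipschitz constant in x grows with \<open>norm w\<close>; therefore
    Rademacher's theorem is applied on bounded sets of w, and the null sets are united.\<close>
  have Gx: "G (x', w) \<le> G (x, w) + k * norm (x - x') * (norm w / r\<^sup>2)" if x: "x \<in> W" "x' \<in> W" for x x' w
  proof -
    define \<rho> where "\<rho> = k * norm (x - x')"
    have \<rho>: "\<rho> \<ge> 0" using kU by (simp add: \<rho>_def)
    have "minkowski (K x') w \<le> (1 + \<rho> / r) * minkowski (K x) w"
      using nearK[OF x] unfolding \<rho>_def[symmetric]
      by (intro minkowski_le_of_near[OF Kc r Kr[OF x(2)] Kc r Kr[OF x(1)] \<rho>]) auto
    moreover have "\<rho> / r * minkowski (K x) w \<le> \<rho> / r * (norm w / r)"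
      using minkowski_le_norm[OF Kc r Kr[OF x(1)]] \<rho> r by (intro mult_left_mono) auto
    ultimately show ?thesis
      by (simp add: G_def \<rho>_def[symmetric] algebra_simps power2_eq_square)
  qed
  have Gw: "\<bar>G (x, w) - G (x, w')\<bar> \<le> norm (w - w') / r" if "x \<in> W" for x w w'
    using lipschitz_onD[OF minkowski_lipschitz[OF Kc r Kr[OF that]], of w w']
    by (simp add: G_def dist_real_def dist_norm)
  have negn: "negligible {z \<in> W \<times> ball 0 (real n). \<not> G differentiable (at z)}" for n
  proof (rule rademacher_open)
    show "open (W \<times> ball (0::'b) (real n))" using W by (intro open_Times) auto
    define L where "L = k * (real n / r\<^sup>2)"
    have L: "L \<ge> 0" using kU by (simp add: L_def)
    show "(L + 1/r)-lipschitz_on (W \<times> ball 0 (real n)) G"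
    proof (rule lipschitz_onI)
      fix z z' assume zz: "z \<in> W \<times> ball (0::'b) (real n)" "z' \<in> W \<times> ball (0::'b) (real n)"
      obtain x w x' w' where z: "z = (x, w)" "z' = (x', w')" by (cases z, cases z')
      then have x: "x \<in> W" "x' \<in> W" and w: "norm w \<le> real n" using zz by auto
      have le: "k * norm (a - b) * (norm w / r\<^sup>2) \<le> L * norm (a - b)" for a b :: 'a
      proof -
        have "norm w / r\<^sup>2 \<le> real n / r\<^sup>2" using w by (simp add: divide_right_mono)
        then have "k * norm (a - b) * (norm w / r\<^sup>2) \<le> k * norm (a - b) * (real n / r\<^sup>2)"
          using kU by (intro mult_left_mono) auto
        then show ?thesis by (simp add: L_def mult_ac)
      qed
      have "\<bar>G (x, w) - G (x', w)\<bar> \<le> L * norm (x - x')"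
        using Gx[OF x, of w] Gx[OF x(2,1), of w] le[of x x'] le[of x' x]
        by (simp add: abs_le_iff norm_minus_commute[of x' x])
      moreover have "\<bar>G (x', w) - G (x', w')\<bar> \<le> 1/r * norm (w - w')" using Gw[OF x(2)] by simp
      moreover have "L * norm (x - x') \<le> L * dist z z'"
        using L dist_fst_le[of z z'] by (intro mult_left_mono) (auto simp: z dist_norm)
      moreover have "1/r * norm (w - w') \<le> 1/r * dist z z'"
        using r dist_snd_le[of z z'] by (intro mult_left_mono) (auto simp: z dist_norm)
      ultimately have "\<bar>G z - G z'\<bar> \<le> L * dist z z' + 1/r * dist z z'" unfolding z by linarith
      then show "dist (G z) (G z') \<le> (L + 1/r) * dist z z'" by (simp add: dist_real_def distrib_right)
    qed (use L r in auto)
  qed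
  define B where "B = {z \<in> W \<times> UNIV. \<not> G differentiable (at z)}"
  have "negligible (\<Union>n. {z \<in> W \<times> ball 0 (real n). \<not> G differentiable (at z)})"
    using negn by (intro negligible_countable_Union) auto
  moreover have "B \<subseteq> (\<Union>n. {z \<in> W \<times> ball 0 (real n). \<not> G differentiable (at z)})"
    using reals_Archimedean2 by (fastforce simp: B_def)
  ultimately have negB: "negligible B" by (rule negligible_subset)
  have cl: "closed (gph F)" using closed_gph[OF lip ne] cpt compact_imp_closed by blast
  have hom: "G (x, t *\<^sub>R w) = t * G (x, w)" if "x \<in> W" "t > 0" for x t w
    using minkowski_scaleR[OF Kc r Kr[OF that(1)] that(2)] by (simp add: G_def)
  have mem: "y \<in> F x \<longleftrightarrow> G (x, y - c) \<le> 1" if "x \<in> W" for x y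
    using minkowski_le_1_iff[OF Kc r Kr[OF that], of "y - c"] by (simp add: G_def KF)
  have "hausdorff_measure (DIM('b) - 1)
             {y \<in> frontier (F x).
                \<not> (sv_differentiable F x y \<and> half_space (gph (graphical_derivative F x y)))} = 0"
    if x: "x \<in> W" and sl: "negligible {w. (x, w) \<in> B}" for x
  proof (rule hausdorff_measure_null_if_cone_negligible[OF minkowski_lipschitz[OF Kc r Kr[OF x]]])
    let ?A = "{y \<in> frontier (F x). \<not> (sv_differentiable F x y \<and> half_space (gph (graphical_derivative F x y)))}"
    have one: "G (x, y - c) = 1" if "y \<in> frontier (F x)" for y
    proof -
      have "y - c \<in> frontier (K x)"
        using that frontier_translation[of "- c" "F x"] by (auto simp: K_def)
      then show ?thesis using minkowski_frontier[OF Kc r Kr[OF x]] by (simp add: G_def)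
    qed
    show "minkowski (K x) (t *\<^sub>R (y - c)) = t" if "y \<in> ?A" "t \<in> {1..2}" for y t
      using hom[OF x, of t "y - c"] one[of y] that by (simp add: G_def)
    show "bounded ?A"
      by (rule bounded_subset[OF compact_imp_bounded[OF compact_frontier[OF cpt]]]) auto
    show "negligible {t *\<^sub>R (y - c) | t y. t \<in> {1..2} \<and> y \<in> ?A}"
    proof (rule negligible_subset[OF sl], rule subsetI)
      fix z assume "z \<in> {t *\<^sub>R (y - c) | t y. t \<in> {1..2} \<and> y \<in> ?A}"
      then obtain t y where z: "z = t *\<^sub>R (y - c)" and t: "t \<in> {1..2}" and y: "y \<in> frontier (F x)"
        and bad: "\<not> (sv_differentiable F x y \<and> half_space (gph (graphical_derivative F x y)))"
        by blast
      have t0: "t > 0" using t by simp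
      \<comment> \<open>By homogeneity, differentiability at t (y - c) would pass to y - c, where it
        yields a half-space. So the whole segment over a bad boundary point lies in the null
        slice.\<close>
      have "\<not> G differentiable (at (x, t *\<^sub>R (y - c)))"
      proof
        assume "G differentiable (at (x, t *\<^sub>R (y - c)))"
        then obtain D where D: "(G has_derivative D) (at (x, t *\<^sub>R (y - c)))" by (auto simp: differentiable_def)
        have 1: "((\<lambda>z. (fst z, t *\<^sub>R snd z)) has_derivative (\<lambda>z. (fst z, t *\<^sub>R snd z))) (at (x, y - c))"
          by (auto intro!: derivative_eq_intros)
        have "((\<lambda>z. G (fst z, t *\<^sub>R snd z)) has_derivative (\<lambda>z. D (fst z, t *\<^sub>R snd z))) (at (x, y - c))"
          using has_derivative_compose[OF 1, of G D] D by simp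
        then have "((\<lambda>z. (1/t) * G (fst z, t *\<^sub>R snd z)) has_derivative (\<lambda>z. (1/t) * D (fst z, t *\<^sub>R snd z))) (at (x, y - c))"
          by (rule has_derivative_mult_right)
        then have "(G has_derivative (\<lambda>z. (1/t) * D (fst z, t *\<^sub>R snd z))) (at (x, y - c))"
        proof (rule has_derivative_transform_within_open)
          show "open (W \<times> (UNIV :: 'b set))" using W by (intro open_Times) auto
          show "(x, y - c) \<in> W \<times> UNIV" using x by simp
          show "1/t * G (fst z, t *\<^sub>R snd z) = G z" if "z \<in> W \<times> UNIV" for z
            using that hom[of "fst z" t "snd z"] t0 by auto
        qed
        then have "G differentiable (at (x, y - c))" by (auto simp: differentiable_def)
        then show False
          using half_space_of_differentiable_gauge[OF cl W(1) x mem hom one[OF y]] bad by blast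
      qed
      then show "z \<in> {w. (x, w) \<in> B}" using x by (simp add: B_def z)
    qed
  qed
  then have "{x \<in> W. hausdorff_measure (DIM('b) - 1)
             {y \<in> frontier (F x).
                \<not> (sv_differentiable F x y \<and> half_space (gph (graphical_derivative F x y)))} \<noteq> 0}
        \<subseteq> {x. \<not> negligible {w. (x, w) \<in> B}}" by blast
  with negligible_slices[OF negB] have "negligible {x \<in> W. hausdorff_measure (DIM('b) - 1)
             {y \<in> frontier (F x).
                \<not> (sv_differentiable F x y \<and> half_space (gph (graphical_derivative F x y)))} \<noteq> 0}"
    by (rule negligible_subset)
  then show ?thesis using that W by blast
qed

theorem theorem5p5:
  fixes F :: "real ^ 'd \<Rightarrow> (real ^ 'l) set"
  assumes "\<And>x. F x \<noteq> {}" and "\<And>x. convex (F x)" and "\<And>x. compact (F x)"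
    and "locally_isotropically_Lipschitz F"
    and "\<And>x. strictly_convex (F x)" and "\<And>x. interior (F x) \<noteq> {}"
  shows "AE x in lebesgue.
           hausdorff_measure (CARD('l) - 1)
             {y \<in> frontier (F x).
                \<not> (sv_differentiable F x y \<and> half_space (gph (graphical_derivative F x y)))} = 0"
proof -
  define S where "S = {x. hausdorff_measure (CARD('l) - 1)
             {y \<in> frontier (F x).
                \<not> (sv_differentiable F x y \<and> half_space (gph (graphical_derivative F x y)))} \<noteq> 0}"
  have "negligible S"
  \<comment> \<open>Negligibility is a local property, so a neighbourhood of each point
    suffices.\<close>
  proof (rule locally_negligible_alt[THEN iffD2], rule ballI)
    fix x0 assume "x0 \<in> S"
    obtain W where W: "open W" "x0 \<in> W"
      and neg: "negligible {x \<in> W. hausdorff_measure (DIM(real ^ 'l) - 1)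
             {y \<in> frontier (F x).
                \<not> (sv_differentiable F x y \<and> half_space (gph (graphical_derivative F x y)))} \<noteq> 0}"
      using negligible_bad_locally[OF assms(1-4,6)] .
    have "negligible (S \<inter> W)"
      by (rule negligible_subset[OF neg]) (auto simp: S_def)
    then show "\<exists>V. openin (top_of_set S) V \<and> x0 \<in> V \<and> negligible V"
      using W \<open>x0 \<in> S\<close> by (intro exI[of _ "S \<inter> W"]) auto
  qed
  then show ?thesis
    unfolding eventually_ae_filter_negligible S_def by blast
qed

end
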